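(* Let $\Sigma$ be a finite CW complex of dimension $d$ and suppose $\Sigma$ has a cellular spanning forest $\Upsilon$ such that $\tilde H_{d-1}(\Upsilon;\mathbb{Z})=\tilde H_{d-1}(\Sigma;\mathbb{Z})$ (via the map induced by inclusion). Then $\{\psi(\operatorname{circ}(\Upsilon,\sigma)):\sigma\in\Sigma_d\setminus\Upsilon\}$ is an integral basis of the flow lattice $\mathcal{F}(\Sigma)=\ker_{\mathbb{Z}}\partial_d$.
   Context: $\Sigma$ has the convention of a unique $(-1)$-cell (reduced homology); $d$-cells are facets, oriented, identified with the standard basis of $C_d(\Sigma;\mathbb{Z})\cong\mathbb{Z}^n$; $\partial_d$ is the cellular boundary map. The cellular matroid is represented over $\mathbb{R}$ by the columns of $\partial_d$. A cellular spanning forest is a subcomplex containing the full $(d-1)$-skeleton, identified with its facet set, whose facets form a basis of the cellular matroid. For $\sigma\notin\Upsilon$, $\operatorname{circ}(\Upsilon,\sigma)$ is the unique circuit contained in $\Upsilon\cup\sigma$. For a circuit $C$, $\psi(C)$ denotes a generator of the rank-one free $\mathbb{Z}$-module of integer vectors in $\ker\partial_d$ supported on $C$ (i.e., a nonzero integer flow vector supported on $C$ whose entries have gcd $1$; determined up to sign). *)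

theory Defs
  imports "HOL-Homology.Homology" "HOL-Algebra.Free_Abelian_Groups"
begin

subsection \<open>Finite CW complexes\<close>

definition disc :: "nat \<Rightarrow> (nat \<Rightarrow> real) topology" where
  "disc n = subtopology (Euclidean_space n) {x. (\<Sum>i<n. (x i)\<^sup>2) \<le> 1}"

definition disc_interior :: "nat \<Rightarrow> (nat \<Rightarrow> real) set" where
  "disc_interior n = {x \<in> topspace (disc n). (\<Sum>i<n. (x i)\<^sup>2) < 1}"

definition disc_boundary :: "nat \<Rightarrow> (nat \<Rightarrow> real) set" where
  "disc_boundary n = {x \<in> topspace (disc n). (\<Sum>i<n. (x i)\<^sup>2) = 1}"

text \<open>Cells are named by elements of a type \<open>'c\<close>. One of the names has dimension \<open>-1\<close>; it stands
  for the empty cell of reduced homology and carries no point of the space, so that its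
  characteristic map is irrelevant. The orientation of a cell of dimension \<open>n \<ge> 0\<close> is a generator of
  \<open>H\<^sub>n(D\<^sup>n, S\<^sup>n\<^sup>-\<^sup>1)\<close>. The \<open>(-1)\<close>-dimensional chain group is taken to be \<open>H\<^sub>0\<close> of the one-point space
  \<open>D\<^sup>0\<close>, and the orientation of the \<open>(-1)\<close>-cell is a generator of that group.\<close>

record ('a, 'c) cw_complex =
  cw_space :: "'a topology"
  cw_cells :: "'c set"
  cw_dim :: "'c \<Rightarrow> int"
  cw_map :: "'c \<Rightarrow> (nat \<Rightarrow> real) \<Rightarrow> 'a"
  cw_orient :: "'c \<Rightarrow> (nat \<Rightarrow> real) chain set"

definition cells_of_dim :: "('a, 'c) cw_complex \<Rightarrow> int \<Rightarrow> 'c set" where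
  "cells_of_dim \<Sigma> k = {c \<in> cw_cells \<Sigma>. cw_dim \<Sigma> c = k}"

definition open_cell :: "('a, 'c) cw_complex \<Rightarrow> 'c \<Rightarrow> 'a set" where
  "open_cell \<Sigma> c = cw_map \<Sigma> c ` disc_interior (nat (cw_dim \<Sigma> c))"

definition skeleton :: "('a, 'c) cw_complex \<Rightarrow> int \<Rightarrow> 'a set" where
  "skeleton \<Sigma> k = (\<Union>c \<in> {c \<in> cw_cells \<Sigma>. 0 \<le> cw_dim \<Sigma> c \<and> cw_dim \<Sigma> c \<le> k}. open_cell \<Sigma> c)"

text \<open>As there are only finitely many cells, closure finiteness and the weak topology need no
  separate axioms.\<close>

definition finite_cw_complex :: "('a, 'c) cw_complex \<Rightarrow> bool" where
  "finite_cw_complex \<Sigma> \<longleftrightarrow>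
     Hausdorff_space (cw_space \<Sigma>) \<and>
     finite (cw_cells \<Sigma>) \<and>
     (\<forall>c \<in> cw_cells \<Sigma>. -1 \<le> cw_dim \<Sigma> c) \<and>
     (\<exists>!c. c \<in> cells_of_dim \<Sigma> (-1)) \<and>
     topspace (cw_space \<Sigma>) = (\<Union>c \<in> {c \<in> cw_cells \<Sigma>. 0 \<le> cw_dim \<Sigma> c}. open_cell \<Sigma> c) \<and>
     (\<forall>c \<in> cw_cells \<Sigma>. \<forall>c' \<in> cw_cells \<Sigma>.
        0 \<le> cw_dim \<Sigma> c \<longrightarrow> 0 \<le> cw_dim \<Sigma> c' \<longrightarrow> c \<noteq> c' \<longrightarrow>
        open_cell \<Sigma> c \<inter> open_cell \<Sigma> c' = {}) \<and>
     (\<forall>c \<in> cw_cells \<Sigma>. 0 \<le> cw_dim \<Sigma> c \<longrightarrow>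
        (let n = nat (cw_dim \<Sigma> c) in
          continuous_map (disc n) (cw_space \<Sigma>) (cw_map \<Sigma> c) \<and>
          homeomorphic_map (subtopology (disc n) (disc_interior n))
            (subtopology (cw_space \<Sigma>) (open_cell \<Sigma> c)) (cw_map \<Sigma> c) \<and>
          cw_map \<Sigma> c ` disc_boundary n \<subseteq> skeleton \<Sigma> (cw_dim \<Sigma> c - 1))) \<and>
     (\<forall>c \<in> cw_cells \<Sigma>.
        (let n = nat (cw_dim \<Sigma> c);
             G = relative_homology_group (int n) (disc n) (disc_boundary n)
         in cw_orient \<Sigma> c \<in> carrier G \<and> generate G {cw_orient \<Sigma> c} = carrier G))"

definition cw_dimension :: "('a, 'c) cw_complex \<Rightarrow> int" where
  "cw_dimension \<Sigma> = Max (cw_dim \<Sigma> ` cw_cells \<Sigma>)"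

definition facets :: "('a, 'c) cw_complex \<Rightarrow> 'c set" where
  "facets \<Sigma> = cells_of_dim \<Sigma> (cw_dimension \<Sigma>)"

subsection \<open>The cellular boundary map\<close>

definition skeleton_homology :: "('a, 'c) cw_complex \<Rightarrow> int \<Rightarrow> 'a chain set monoid" where
  "skeleton_homology \<Sigma> k =
     relative_homology_group k (subtopology (cw_space \<Sigma>) (skeleton \<Sigma> k)) (skeleton \<Sigma> (k - 1))"

definition cell_class :: "('a, 'c) cw_complex \<Rightarrow> 'c \<Rightarrow> 'a chain set" where
  "cell_class \<Sigma> c =
     (let k = cw_dim \<Sigma> c in
       hom_induced k (disc (nat k)) (disc_boundary (nat k))
         (subtopology (cw_space \<Sigma>) (skeleton \<Sigma> k)) (skeleton \<Sigma> (k - 1))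
         (cw_map \<Sigma> c) (cw_orient \<Sigma> c))"

text \<open>\<open>cellular_boundary \<Sigma> bd\<close> says that \<open>bd \<sigma>\<close> is the boundary of the cell \<open>\<sigma>\<close> written in the basis of
  cells: for \<open>k \<ge> 1\<close> the cellular boundary map
  \<open>H\<^sub>k(X\<^sup>k, X\<^sup>k\<^sup>-\<^sup>1) \<rightarrow> H\<^sub>k\<^sub>-\<^sub>1(X\<^sup>k\<^sup>-\<^sup>1, X\<^sup>k\<^sup>-\<^sup>2)\<close> sends the class of \<open>\<sigma>\<close> to the combination of cell classes with
  coefficients \<open>bd \<sigma>\<close>, and for \<open>k = 0\<close> the augmentation induced by the map to a point does so. The
  classes of the \<open>k\<close>-cells are a basis of \<open>H\<^sub>k(X\<^sup>k, X\<^sup>k\<^sup>-\<^sup>1)\<close>, so on the cells of \<open>\<Sigma>\<close> there is exactly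
  one such \<open>bd\<close>. The \<open>(-1)\<close>-cell has boundary \<open>0\<close> by the support condition.\<close>

definition cellular_boundary :: "('a, 'c) cw_complex \<Rightarrow> ('c \<Rightarrow> ('c \<Rightarrow>\<^sub>0 int)) \<Rightarrow> bool" where
  "cellular_boundary \<Sigma> bd \<longleftrightarrow>
     (\<forall>\<sigma> \<in> cw_cells \<Sigma>.
        (let k = cw_dim \<Sigma> \<sigma> in
          Poly_Mapping.keys (bd \<sigma>) \<subseteq> cells_of_dim \<Sigma> (k - 1) \<and>
          (1 \<le> k \<longrightarrow>
             hom_relboundary k (subtopology (cw_space \<Sigma>) (skeleton \<Sigma> k))
               (skeleton \<Sigma> (k - 1)) (skeleton \<Sigma> (k - 2)) (cell_class \<Sigma> \<sigma>) =
             finprod (skeleton_homology \<Sigma> (k - 1))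
               (\<lambda>\<tau>. cell_class \<Sigma> \<tau> [^]\<^bsub>skeleton_homology \<Sigma> (k - 1)\<^esub> Poly_Mapping.lookup (bd \<sigma>) \<tau>)
               (cells_of_dim \<Sigma> (k - 1))) \<and>
          (k = 0 \<longrightarrow>
             hom_induced 0 (subtopology (cw_space \<Sigma>) (skeleton \<Sigma> 0)) {} (disc 0) {} (\<lambda>_ _. 0)
               (cell_class \<Sigma> \<sigma>) =
             finprod (homology_group 0 (disc 0))
               (\<lambda>\<tau>. cw_orient \<Sigma> \<tau> [^]\<^bsub>homology_group 0 (disc 0)\<^esub> Poly_Mapping.lookup (bd \<sigma>) \<tau>)
               (cells_of_dim \<Sigma> (-1)))))"

subsection \<open>Reduced cellular homology of a subcomplex\<close>

text \<open>Below, a subcomplex is given by its set \<open>K\<close> of cells, including the \<open>(-1)\<close>-cell.\<close>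

definition cellular_chains :: "('a, 'c) cw_complex \<Rightarrow> 'c set \<Rightarrow> int \<Rightarrow> ('c \<Rightarrow>\<^sub>0 int) monoid" where
  "cellular_chains \<Sigma> K k = free_Abelian_group {c \<in> K. cw_dim \<Sigma> c = k}"

definition cellular_cycles ::
    "('a, 'c) cw_complex \<Rightarrow> ('c \<Rightarrow> ('c \<Rightarrow>\<^sub>0 int)) \<Rightarrow> 'c set \<Rightarrow> int \<Rightarrow> ('c \<Rightarrow>\<^sub>0 int) set" where
  "cellular_cycles \<Sigma> bd K k =
     kernel (cellular_chains \<Sigma> K k) (cellular_chains \<Sigma> K (k - 1)) (frag_extend bd)"

definition cellular_boundaries ::
    "('a, 'c) cw_complex \<Rightarrow> ('c \<Rightarrow> ('c \<Rightarrow>\<^sub>0 int)) \<Rightarrow> 'c set \<Rightarrow> int \<Rightarrow> ('c \<Rightarrow>\<^sub>0 int) set" where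
  "cellular_boundaries \<Sigma> bd K k = frag_extend bd ` carrier (cellular_chains \<Sigma> K (k + 1))"

definition cellular_homology ::
    "('a, 'c) cw_complex \<Rightarrow> ('c \<Rightarrow> ('c \<Rightarrow>\<^sub>0 int)) \<Rightarrow> 'c set \<Rightarrow> int \<Rightarrow> ('c \<Rightarrow>\<^sub>0 int) set monoid" where
  "cellular_homology \<Sigma> bd K k =
     subgroup_generated (cellular_chains \<Sigma> K k) (cellular_cycles \<Sigma> bd K k)
       Mod cellular_boundaries \<Sigma> bd K k"

definition homology_class ::
    "('a, 'c) cw_complex \<Rightarrow> ('c \<Rightarrow> ('c \<Rightarrow>\<^sub>0 int)) \<Rightarrow> 'c set \<Rightarrow> int \<Rightarrow> ('c \<Rightarrow>\<^sub>0 int) \<Rightarrow> ('c \<Rightarrow>\<^sub>0 int) set"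
  where
  "homology_class \<Sigma> bd K k z =
     r_coset (cellular_chains \<Sigma> K k) (cellular_boundaries \<Sigma> bd K k) z"

definition inclusion_induces_iso ::
    "('a, 'c) cw_complex \<Rightarrow> ('c \<Rightarrow> ('c \<Rightarrow>\<^sub>0 int)) \<Rightarrow> 'c set \<Rightarrow> 'c set \<Rightarrow> int \<Rightarrow> bool" where
  "inclusion_induces_iso \<Sigma> bd K L k \<longleftrightarrow>
     (\<exists>f \<in> iso (cellular_homology \<Sigma> bd K k) (cellular_homology \<Sigma> bd L k).
        \<forall>z \<in> cellular_cycles \<Sigma> bd K k. f (homology_class \<Sigma> bd K k z) = homology_class \<Sigma> bd L k z)"

subsection \<open>The cellular matroid and spanning forests\<close>

text \<open>Independence is that of the family of columns, so equal columns are parallel elements.\<close>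

definition cellular_independent ::
    "('a, 'c) cw_complex \<Rightarrow> ('c \<Rightarrow> ('c \<Rightarrow>\<^sub>0 int)) \<Rightarrow> 'c set \<Rightarrow> bool" where
  "cellular_independent \<Sigma> bd A \<longleftrightarrow>
     A \<subseteq> facets \<Sigma> \<and>
     (\<forall>a :: 'c \<Rightarrow> real.
        (\<forall>\<rho>. (\<Sum>\<sigma>\<in>A. a \<sigma> * real_of_int (Poly_Mapping.lookup (bd \<sigma>) \<rho>)) = 0) \<longrightarrow> (\<forall>\<sigma>\<in>A. a \<sigma> = 0))"

definition cellular_basis ::
    "('a, 'c) cw_complex \<Rightarrow> ('c \<Rightarrow> ('c \<Rightarrow>\<^sub>0 int)) \<Rightarrow> 'c set \<Rightarrow> bool" where
  "cellular_basis \<Sigma> bd B \<longleftrightarrow>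
     cellular_independent \<Sigma> bd B \<and> (\<forall>A. cellular_independent \<Sigma> bd A \<and> B \<subseteq> A \<longrightarrow> A = B)"

definition cellular_circuit ::
    "('a, 'c) cw_complex \<Rightarrow> ('c \<Rightarrow> ('c \<Rightarrow>\<^sub>0 int)) \<Rightarrow> 'c set \<Rightarrow> bool" where
  "cellular_circuit \<Sigma> bd C \<longleftrightarrow>
     C \<subseteq> facets \<Sigma> \<and> \<not> cellular_independent \<Sigma> bd C \<and> (\<forall>A. A \<subset> C \<longrightarrow> cellular_independent \<Sigma> bd A)"

text \<open>A spanning forest is identified with its set \<open>\<Upsilon>\<close> of facets; the subcomplex itself is
  \<open>spanning_subcomplex \<Sigma> \<Upsilon>\<close>.\<close>

definition spanning_subcomplex :: "('a, 'c) cw_complex \<Rightarrow> 'c set \<Rightarrow> 'c set" where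
  "spanning_subcomplex \<Sigma> \<Upsilon> = {c \<in> cw_cells \<Sigma>. cw_dim \<Sigma> c < cw_dimension \<Sigma>} \<union> \<Upsilon>"

definition cellular_spanning_forest ::
    "('a, 'c) cw_complex \<Rightarrow> ('c \<Rightarrow> ('c \<Rightarrow>\<^sub>0 int)) \<Rightarrow> 'c set \<Rightarrow> bool" where
  "cellular_spanning_forest \<Sigma> bd \<Upsilon> \<longleftrightarrow> \<Upsilon> \<subseteq> facets \<Sigma> \<and> cellular_basis \<Sigma> bd \<Upsilon>"

definition circ ::
    "('a, 'c) cw_complex \<Rightarrow> ('c \<Rightarrow> ('c \<Rightarrow>\<^sub>0 int)) \<Rightarrow> 'c set \<Rightarrow> 'c \<Rightarrow> 'c set" where
  "circ \<Sigma> bd \<Upsilon> \<sigma> = (THE C. cellular_circuit \<Sigma> bd C \<and> C \<subseteq> insert \<sigma> \<Upsilon>)"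

subsection \<open>The flow lattice\<close>

definition flow_lattice ::
    "('a, 'c) cw_complex \<Rightarrow> ('c \<Rightarrow> ('c \<Rightarrow>\<^sub>0 int)) \<Rightarrow> ('c \<Rightarrow>\<^sub>0 int) set" where
  "flow_lattice \<Sigma> bd = cellular_cycles \<Sigma> bd (cw_cells \<Sigma>) (cw_dimension \<Sigma>)"

definition circuit_vector ::
    "('a, 'c) cw_complex \<Rightarrow> ('c \<Rightarrow> ('c \<Rightarrow>\<^sub>0 int)) \<Rightarrow> 'c set \<Rightarrow> ('c \<Rightarrow>\<^sub>0 int) \<Rightarrow> bool" where
  "circuit_vector \<Sigma> bd C v \<longleftrightarrow>
     {x \<in> flow_lattice \<Sigma> bd. Poly_Mapping.keys x \<subseteq> C} = range (\<lambda>m :: int. frag_cmul m v)"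

definition integral_basis :: "('c \<Rightarrow>\<^sub>0 int) set \<Rightarrow> ('c \<Rightarrow>\<^sub>0 int) set \<Rightarrow> bool" where
  "integral_basis L B \<longleftrightarrow>
     finite B \<and>
     L = range (\<lambda>a. \<Sum>b\<in>B. frag_cmul (a b) b) \<and>
     (\<forall>a. (\<Sum>b\<in>B. frag_cmul (a b) b) = 0 \<longrightarrow> (\<forall>b\<in>B. a b = 0))"

end

theory Submission
  imports Defs
begin

text \<open>
  For a facet \<open>\<sigma>\<close> outside the forest \<open>\<Upsilon>\<close>, the cycle \<open>bd \<sigma>\<close> bounds in \<open>\<Sigma>\<close>, so injectivity of
  \<open>H\<^sub>d\<^sub>-\<^sub>1(\<Upsilon>) \<rightarrow> H\<^sub>d\<^sub>-\<^sub>1(\<Sigma>)\<close> makes it the boundary of a chain \<open>y\<close> supported on \<open>\<Upsilon>\<close>. The flow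
  \<open>w = \<sigma> - y\<close> is supported on \<open>insert \<sigma> \<Upsilon>\<close> and has coefficient 1 at \<open>\<sigma>\<close>; independence of \<open>\<Upsilon>\<close> shows that its
  support is the fundamental circuit of \<open>\<sigma>\<close> and hence that \<open>\<psi>\<close> of that circuit is \<open>w\<close> or \<open>- w\<close>. Modulo signs the
  family is therefore the identity matrix on the facets outside \<open>\<Upsilon>\<close>, and a flow vanishing there is 0.

  That \<open>bd \<sigma>\<close> is a cycle is not part of the definition of \<open>cellular_boundary\<close>: it needs the
  linear independence of the cell classes in \<open>H\<^sub>k(X\<^sup>k, X\<^sup>k\<^sup>-\<^sup>1)\<close>, which is detected cell by cell in the local
  homology \<open>H\<^sub>k(X\<^sup>k, X\<^sup>k - {center})\<close>.
\<close>

subsection \<open>Homology of the disc relative to its boundary\<close>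

lemma topspace_disc: "topspace (disc n) = {x. (\<forall>i\<ge>n. x i = 0) \<and> (\<Sum>i<n. (x i)\<^sup>2) \<le> 1}"
  by (auto simp: disc_def topspace_Euclidean_space)

text \<open>Passes from a subspace of the product topology to the type-class topology on functions,
  where closedness and compactness are easy to establish.\<close>

lemma disc_eq_top_of_set: "disc n = top_of_set (topspace (disc n))"
  unfolding topspace_disc
  by (simp add: disc_def Euclidean_space_def euclidean_product_topology subtopology_subtopology Collect_conj_eq)

lemma continuous_map_disc_component: "continuous_map (disc n) euclideanreal (\<lambda>x. x i)"
  unfolding disc_def Euclidean_space_def
  by (intro continuous_map_from_subtopology continuous_map_product_projection) simp

lemma continuous_map_into_disc_subtopology:
  "continuous_map X (subtopology (disc n) S) f \<longleftrightarrow>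
     (\<forall>i. continuous_map X euclideanreal (\<lambda>x. f x i)) \<and> f \<in> topspace X \<rightarrow> topspace (disc n) \<inter> S"
  unfolding topspace_disc
  by (auto simp: disc_def Euclidean_space_def subtopology_subtopology continuous_map_in_subtopology
      continuous_map_componentwise_UNIV Pi_iff)

lemma Hausdorff_space_disc: "Hausdorff_space (disc n)"
  unfolding disc_def Euclidean_space_def
  by (intro Hausdorff_space_subtopology) (simp add: Hausdorff_space_product_topology)

text \<open>The disc is closed inside the cube of functions with values in [-1,1], which is compact
  by Tychonoff. Compactness later makes closed cells closed in the Hausdorff space of the
  complex.\<close>

lemma compact_space_disc: "compact_space (disc n)"
proof -
  let ?K = "Pi\<^sub>E UNIV (\<lambda>i. {-1..1::real})"
  have "compactin (powertop_real UNIV) ?K"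
    by (simp add: compactin_PiE)
  then have "compact ?K"
    by (simp add: euclidean_product_topology)
  moreover have "closed (topspace (disc n))"
    unfolding topspace_disc
    by (intro closed_Collect_conj closed_Collect_all closed_Collect_imp closed_Collect_eq closed_Collect_le
       continuous_on_sum continuous_on_power continuous_on_product_coordinates continuous_on_const open_Collect_const)
  moreover have "topspace (disc n) \<subseteq> ?K"
  proof
    fix x assume x: "x \<in> topspace (disc n)"
    have "(x i)\<^sup>2 \<le> 1" for i
    proof (cases "i < n")
      case True
      then have "(x i)\<^sup>2 \<le> (\<Sum>i<n. (x i)\<^sup>2)"
        by (intro member_le_sum) auto
      with x show ?thesis by (auto simp: topspace_disc)
    qed (use x in \<open>auto simp: topspace_disc\<close>)
    then show "x \<in> ?K"
      by (simp add: abs_square_le_1 abs_le_iff PiE_UNIV_domain)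
  qed
  ultimately have "compact (topspace (disc n))"
    by (metis compact_Int_closed inf.absorb2)
  then show ?thesis
    by (subst disc_eq_top_of_set) (simp add: compact_space_subtopology)
qed

lemma contractible_space_disc: "contractible_space (disc n)"
proof -
  \<comment> \<open>Straight-line homotopy from the identity at \<open>t = 0\<close> to the constant
    map at the origin at \<open>t = 1\<close>.\<close>
  let ?h = "\<lambda>(t, x) i. (1 - t) * x i :: real"
  have "continuous_map (prod_topology (top_of_set {0..1}) (disc n)) (subtopology (disc n) UNIV) ?h"
    unfolding continuous_map_into_disc_subtopology
  proof (intro conjI allI)
    fix i
    have "continuous_map (prod_topology (top_of_set {0..1}) (disc n)) euclideanreal (\<lambda>p. (1 - fst p) * snd p i)"
      using continuous_map_compose [OF continuous_map_snd continuous_map_disc_component]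
      by (intro continuous_intros continuous_map_into_fulltopology [OF continuous_map_fst]) (simp add: comp_def)
    then show "continuous_map (prod_topology (top_of_set {0..1}) (disc n)) euclideanreal (\<lambda>p. ?h p i)"
      by (simp add: case_prod_unfold)
  next
    have "(\<Sum>i<n. ((1 - t) * x i)\<^sup>2) \<le> 1" if "0 \<le> t" "t \<le> 1" "(\<Sum>i<n. (x i)\<^sup>2) \<le> 1" for t :: real and x
    proof -
      have "(\<Sum>i<n. ((1 - t) * x i)\<^sup>2) = (1 - t)\<^sup>2 * (\<Sum>i<n. (x i)\<^sup>2)"
        by (simp add: power_mult_distrib sum_distrib_left)
      also have "\<dots> \<le> 1 * 1"
        using that by (intro mult_mono power_le_one) (auto intro: sum_nonneg)
      finally show ?thesis by simp
    qed
    then show "?h \<in> topspace (prod_topology (top_of_set {0..1}) (disc n)) \<rightarrow> topspace (disc n) \<inter> UNIV"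
      by (auto simp: topspace_disc)
  qed
  then have "homotopic_with (\<lambda>_. True) (disc n) (disc n) id (\<lambda>x i. 0)"
    unfolding homotopic_with_def by (intro exI [of _ ?h]) auto
  then show ?thesis
    unfolding contractible_space_def by blast
qed

section \<open>The boundary sphere and the order of a generator of H_n(D^n, S^(n-1))\<close>

lemma disc_boundary_conv_interior: "disc_boundary n = topspace (disc n) - disc_interior n"
  by (auto simp: disc_boundary_def disc_interior_def topspace_disc)

lemma zero_in_disc_interior: "(\<lambda>_. 0) \<in> disc_interior n"
  by (simp add: disc_interior_def topspace_disc)

lemma closedin_disc_boundary: "closedin (disc n) (disc_boundary n)"
proof -
  have "closedin (disc n) {x \<in> topspace (disc n). (\<Sum>i<n. (x i)\<^sup>2) \<in> {1}}"
    by (rule closedin_continuous_map_preimage [where Y = euclideanreal])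
       (auto intro!: continuous_intros continuous_map_disc_component)
  then show ?thesis
    by (simp add: disc_boundary_def)
qed

text \<open>Index shift: \<open>nsphere n\<close> is the n-dimensional sphere, which uses
  \<open>Suc n\<close> coordinates.\<close>

lemma subtopology_disc_boundary: "subtopology (disc (Suc n)) (disc_boundary (Suc n)) = nsphere n"
proof -
  have "{x. (\<Sum>i<Suc n. (x i)\<^sup>2) \<le> 1} \<inter> disc_boundary (Suc n) 
     = topspace (Euclidean_space (Suc n)) \<inter> {x. (\<Sum>i\<le>n. (x i)\<^sup>2) = 1}"
    by (auto simp: disc_boundary_def topspace_disc lessThan_Suc_atMost topspace_Euclidean_space)
  then show ?thesis
    by (simp add: disc_def nsphere_def subtopology_subtopology subtopology_restrict flip: lessThan_Suc_atMost)
qed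

text \<open>For positive \<open>n\<close>, contractibility of the disc identifies the group with the
  reduced homology of S^(n-1) in degree n-1. For \<open>n = 0\<close> the boundary is empty and the
  group is H_0 of a point. Infinitude then forces every generator to have infinite order.\<close>

lemma infinite_relative_homology_group_disc:
  "infinite (carrier (relative_homology_group (int n) (disc n) (disc_boundary n)))"
proof -
  have "relative_homology_group (int n) (disc n) (disc_boundary n) \<cong> integer_group"
  proof (cases n)
    case 0
    have "topspace (disc 0) = {\<lambda>_. 0}" "disc_boundary 0 = {}"
      by (auto simp: topspace_disc disc_boundary_def)
    then show ?thesis
      using homology_coefficients [of "disc 0" "\<lambda>_. 0"] 0 by simp
  next
    case (Suc m)
    have "topspace (disc n) \<inter> disc_boundary n \<noteq> {}"
      using Suc subtopology_disc_boundary[of m] nonempty_nsphere[of m]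
      by (metis topspace_subtopology null_topspace_iff_trivial)
    then have "relative_homology_group (int n) (disc n) (disc_boundary n)
        \<cong> reduced_homology_group (int n - 1) (subtopology (disc n) (disc_boundary n))"
      by (rule isomorphic_group_relative_homology_of_contractible [OF contractible_space_disc])
    also have "reduced_homology_group (int n - 1) (subtopology (disc n) (disc_boundary n)) \<cong> integer_group"
      using reduced_homology_group_nsphere(1)[of m] Suc by (simp add: subtopology_disc_boundary)
    finally show ?thesis .
  qed
  then have "carrier (relative_homology_group (int n) (disc n) (disc_boundary n)) \<approx> (UNIV :: int set)"
    using iso_imp_eqpoll_carrier by fastforce
  then show ?thesis
    by (metis eqpoll_finite_iff infinite_UNIV_int)
qed

lemma disc_generator_int_pow_eq_one:
  fixes m :: int
  defines "G \<equiv> \<lambda>n. relative_homology_group (int n) (disc n) (disc_boundary n)"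
  assumes x: "x \<in> carrier (G n)" and gen: "generate (G n) {x} = carrier (G n)"
    and "x [^]\<^bsub>G n\<^esub> m = \<one>\<^bsub>G n\<^esub>"
  shows "m = 0"
proof -
  interpret group "G n" by (simp add: G_def)
  have "infinite (carrier (subgroup_generated (G n) {x}))"
    using x gen infinite_relative_homology_group_disc[of n] by (simp add: carrier_subgroup_generated G_def)
  then have "ord x = 0"
    using infinite_cyclic_subgroup_order[OF x] by simp
  then show ?thesis
    using int_pow_eq_id[OF x, of m] assms(4) by simp
qed

text \<open>The retraction is the radial projection x / |x|.\<close>

lemma disc_boundary_retract_of_punctured_disc:
  assumes "0 < n"
  shows "disc_boundary n retract_of_space subtopology (disc n) (topspace (disc n) - {\<lambda>_. 0})"
proof -
  let ?X = "subtopology (disc n) (topspace (disc n) - {\<lambda>_. 0})"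
  let ?r = "\<lambda>x i. x i / sqrt (\<Sum>j<n. (x j)\<^sup>2)"
  have pos: "(\<Sum>j<n. (x j)\<^sup>2) > 0" if "x \<in> topspace ?X" for x
  proof -
    have "\<exists>i<n. x i \<noteq> 0"
      using that by (auto simp: topspace_disc fun_eq_iff) (metis linorder_not_le)
    then obtain i where "i < n" "x i \<noteq> 0" by blast
    then show ?thesis
      by (intro sum_pos2[of _ i]) auto
  qed
  have unit: "(\<Sum>i<n. (?r x i)\<^sup>2) = 1" if "x \<in> topspace ?X" for x
    using pos[OF that] by (simp add: power_divide flip: sum_divide_distrib)
  have "continuous_map ?X (subtopology (disc n) (disc_boundary n)) ?r"
    unfolding continuous_map_into_disc_subtopology
  proof (intro conjI allI)
    fix i show "continuous_map ?X euclideanreal (\<lambda>x. ?r x i)"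
      using pos by (intro continuous_intros continuous_map_from_subtopology continuous_map_disc_component)
          force+
  next
    show "?r \<in> topspace ?X \<rightarrow> topspace (disc n) \<inter> disc_boundary n"
      using unit by (auto simp: disc_boundary_def topspace_disc)
  qed
  moreover have "?r x = x" if "x \<in> disc_boundary n" for x
    using that by (auto simp: disc_boundary_def)
  moreover have sub: "disc_boundary n \<subseteq> topspace ?X"
    using assms by (auto simp: disc_boundary_def)
  moreover have "subtopology ?X (disc_boundary n) = subtopology (disc n) (disc_boundary n)"
    using sub by (simp add: subtopology_subtopology Int_absorb1)
  ultimately show ?thesis
    unfolding retract_of_space_def by (intro conjI exI[of _ ?r]) auto
qed

text \<open>The connecting map H_p(D,S) -> H_(p-1)(S) is injective because D is contractible, and
  H_(p-1)(S) -> H_(p-1)(D - 0) is injective because S is a retract. By naturality their composite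
  factors through the map in question, which is therefore injective too.\<close>

lemma inj_on_hom_induced_disc_punctured:
  "inj_on (hom_induced p (disc n) (disc_boundary n) (disc n) (topspace (disc n) - {\<lambda>_. 0}) id)
     (carrier (relative_homology_group p (disc n) (disc_boundary n)))"
proof (cases "n = 0")
  case True
  then have "disc_boundary n = {}" and P: "topspace (disc n) - {\<lambda>_. 0} = {}"
    by (auto simp: topspace_disc disc_boundary_def)
  \<comment> \<open>In dimension 0 both subspaces are empty, so the induced map is the
    identity.\<close>
  then show ?thesis
    unfolding P by (simp add: inj_on_def hom_induced_id)
next
  case False
  let ?D = "disc n" and ?B = "disc_boundary n" and ?P = "topspace (disc n) - {\<lambda>_. 0}"
  have sub: "?B \<subseteq> ?P"
    using False by (auto simp: disc_boundary_def)
  have ne: "topspace ?D \<inter> ?B \<noteq> {}"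
    using subtopology_disc_boundary[of "n - 1"] nonempty_nsphere[of "n - 1"] False
    by (metis Suc_pred' neq0_conv topspace_subtopology null_topspace_iff_trivial)
  have "inj_on (hom_induced (p-1) (subtopology ?D ?B) {} (subtopology ?D ?P) {} id)
          (carrier (homology_group (p-1) (subtopology ?D ?B)))"
    using inj_on_hom_induced_inclusion[of ?B "subtopology ?D ?P" "p-1"]
      disc_boundary_retract_of_punctured_disc[of n] False sub
    by (simp add: subtopology_subtopology Int_absorb1)
  moreover have "hom_boundary p ?D ?B ` carrier (relative_homology_group p ?D ?B)
      \<subseteq> carrier (homology_group (p-1) (subtopology ?D ?B))"
    by (simp add: hom_boundary_carrier image_subsetI)
  moreover have "inj_on (hom_boundary p ?D ?B) (carrier (relative_homology_group p ?D ?B))"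
    using iso_relative_homology_of_contractible[OF contractible_space_disc ne]
    by (simp add: iso_def bij_betw_def)
  ultimately have "inj_on (hom_induced (p-1) (subtopology ?D ?B) {} (subtopology ?D ?P) {} id \<circ> hom_boundary p ?D ?B)
      (carrier (relative_homology_group p ?D ?B))"
    by (meson comp_inj_on inj_on_subset)
  also have "hom_induced (p-1) (subtopology ?D ?B) {} (subtopology ?D ?P) {} id \<circ> hom_boundary p ?D ?B
     = hom_boundary p ?D ?P \<circ> hom_induced p ?D ?B ?D ?P id"
    using sub by (subst naturality_hom_induced) (auto simp: id_def)
  finally show ?thesis
    by (rule inj_on_imageI2)
qed

text \<open>Makes the characteristic map a map of pairs from the punctured disc to the space
  punctured at the center of the cell.\<close>

lemma characteristic_map_eq_center:
  assumes inj: "inj_on f (disc_interior n)" and disj: "f ` disc_boundary n \<inter> f ` disc_interior n = {}"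
    and x: "x \<in> topspace (disc n)" and eq: "f x = f (\<lambda>_. 0)"
  shows "x = (\<lambda>_. 0)"
proof (cases "x \<in> disc_interior n")
  case True
  then show ?thesis using inj eq zero_in_disc_interior by (auto dest: inj_onD)
next
  case False
  then show ?thesis
    using x eq disj zero_in_disc_interior by (auto simp: disc_boundary_conv_interior)
qed

text \<open>Excision on both sides of the characteristic map reduces the claim to a homeomorphism of
  the open disc onto the open cell.\<close>

lemma inj_on_hom_induced_local_homology:
  assumes Y: "Hausdorff_space Y" and cont: "continuous_map (disc n) Y f"
    and ope: "openin Y (f ` disc_interior n)"
    and homeo: "homeomorphic_map (subtopology (disc n) (disc_interior n)) (subtopology Y (f ` disc_interior n)) f"
    and disj: "f ` disc_boundary n \<inter> f ` disc_interior n = {}"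
  shows "inj_on (hom_induced p (disc n) (disc_boundary n) Y (topspace Y - {f (\<lambda>_. 0)}) f)
     (carrier (relative_homology_group p (disc n) (disc_boundary n)))"
proof -
  let ?D = "disc n" and ?B = "disc_boundary n" and ?I = "disc_interior n"
  let ?P = "topspace ?D - {\<lambda>_. 0}" and ?c = "f (\<lambda>_. 0)"
  let ?E = "f ` ?I" and ?Q = "topspace Y - {f (\<lambda>_. 0)}"
  let ?H = "relative_homology_group p"
  have ID: "?I \<subseteq> topspace ?D" by (auto simp: disc_interior_def)
  have EY: "?E \<subseteq> topspace Y" by (rule openin_subset[OF ope])
  have inj: "inj_on f ?I"
    using homeomorphic_imp_injective_map[OF homeo] ID by (simp add: Int_absorb1)
  have fP: "f ` ?P \<subseteq> ?Q"
  proof (rule image_subsetI)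
    fix x assume "x \<in> ?P"
    then have "f x \<in> topspace Y" "f x \<noteq> ?c"
      using continuous_map_image_subset_topspace[OF cont] characteristic_map_eq_center[OF inj disj] by auto
    then show "f x \<in> ?Q" by simp
  qed
  have PB: "?P - ?B = ?I - {\<lambda>_. 0}" and DB: "topspace ?D - ?B = ?I"
    using ID by (auto simp: disc_boundary_conv_interior)
  have U: "?Q - (topspace Y - ?E) = ?E - {?c}" and YE: "topspace Y - (topspace Y - ?E) = ?E"
    using EY by auto
  have zD: "(\<lambda>_. 0) \<in> topspace ?D" using zero_in_disc_interior ID by blast
  \<comment> \<open>Excision of the boundary sphere from the pair (disc, punctured disc).\<close>
  have 1: "hom_induced p (subtopology ?D ?I) (?I - {\<lambda>_. 0}) ?D ?P id
     \<in> iso (?H (subtopology ?D ?I) (?I - {\<lambda>_. 0})) (?H ?D ?P)"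
  proof -
    have "openin ?D ?P"
      by (simp add: Hausdorff_imp_t1_space Hausdorff_space_disc openin_diff closedin_t1_singleton zD)
    moreover have "?B \<subseteq> ?P \<or> n = 0"
      by (auto simp: disc_boundary_def)
    moreover have "?B = {}" if "n = 0"
      using that by (auto simp: disc_boundary_def)
    ultimately have "?D closure_of ?B \<subseteq> ?D interior_of ?P"
      by (auto simp: closure_of_closedin closedin_disc_boundary interior_of_openin)
    from homology_excision_axiom[OF this, of "topspace ?D" p] show ?thesis
      by (simp add: PB DB)
  qed
  \<comment> \<open>Excision of the complement of the open cell; it is closed because the cell is
    open in \<open>Y\<close>.\<close>
  have 2: "hom_induced p (subtopology Y ?E) (?E - {?c}) Y ?Q id
     \<in> iso (?H (subtopology Y ?E) (?E - {?c})) (?H Y ?Q)"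
  proof -
    have "?c \<in> topspace Y"
      using EY zero_in_disc_interior by blast
    then have "openin Y ?Q"
      by (simp add: openin_diff closedin_t1_singleton Hausdorff_imp_t1_space Y)
    moreover have "closedin Y (topspace Y - ?E)"
      using ope by blast
    moreover have "topspace Y - ?E \<subseteq> ?Q"
      using zero_in_disc_interior by blast
    ultimately have "Y closure_of (topspace Y - ?E) \<subseteq> Y interior_of ?Q"
      by (simp add: closure_of_closedin interior_of_openin)
    from homology_excision_axiom[OF this, of "topspace Y" p] show ?thesis
      by (simp only: U YE) (simp add: subtopology_topspace)
  qed
  have 3: "hom_induced p (subtopology ?D ?I) (?I - {\<lambda>_. 0}) (subtopology Y ?E) (?E - {?c}) f
     \<in> iso (?H (subtopology ?D ?I) (?I - {\<lambda>_. 0})) (?H (subtopology Y ?E) (?E - {?c}))"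
    using inj zero_in_disc_interior[of n] ID
    by (intro homeomorphic_map_relative_homology_iso[OF homeo]) (auto simp: inj_on_def)
  let ?i = "hom_induced p (subtopology ?D ?I) (?I - {\<lambda>_. 0}) ?D ?P id"
  let ?e = "hom_induced p (subtopology Y ?E) (?E - {?c}) Y ?Q id"
  let ?g = "hom_induced p (subtopology ?D ?I) (?I - {\<lambda>_. 0}) (subtopology Y ?E) (?E - {?c}) f"
  let ?h = "hom_induced p ?D ?P Y ?Q f"
  \<comment> \<open>Commuting square: both routes from the open disc to \<open>Y\<close> are induced
    by \<open>f\<close>, and the route \<open>?e \<circ> ?g\<close> through the open cell is an
    isomorphism.\<close>
  have "?h \<circ> ?i = hom_induced p (subtopology ?D ?I) (?I - {\<lambda>_. 0}) Y ?Q (f \<circ> id)"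
  proof (rule hom_induced_compose[symmetric])
    show "id \<in> ?I - {\<lambda>_. 0} \<rightarrow> ?P" using ID by auto
    show "f \<in> ?P \<rightarrow> ?Q" using fP by (simp only: image_subset_iff_funcset)
  qed (simp_all add: cont continuous_map_from_subtopology)
  also have "\<dots> = hom_induced p (subtopology ?D ?I) (?I - {\<lambda>_. 0}) Y ?Q (id \<circ> f)"
    by simp
  also have "\<dots> = ?e \<circ> ?g"
  proof (rule hom_induced_compose)
    show "continuous_map (subtopology ?D ?I) (subtopology Y ?E) f"
      using homeo homeomorphic_imp_continuous_map by blast
    show "f \<in> ?I - {\<lambda>_. 0} \<rightarrow> ?E - {?c}"
      using inj zero_in_disc_interior[of n] by (auto simp: inj_on_def)
    show "id \<in> ?E - {?c} \<rightarrow> ?Q"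
      using EY by auto
  qed (simp add: continuous_map_from_subtopology)
  finally have "inj_on (?h \<circ> ?i) (carrier (?H (subtopology ?D ?I) (?I - {\<lambda>_. 0})))"
    using iso_set_trans[OF 3 2] by (simp only: iso_def bij_betw_def mem_Collect_eq)
  \<comment> \<open>Since \<open>?i\<close> is onto, injectivity of the composite passes to
    \<open>?h\<close> on its whole domain.\<close>
  then have "inj_on ?h (?i ` carrier (?H (subtopology ?D ?I) (?I - {\<lambda>_. 0})))"
    by (rule inj_on_imageI)
  then have inj_h: "inj_on ?h (carrier (?H ?D ?P))"
    using 1 by (simp only: iso_def bij_betw_def mem_Collect_eq)
  have "hom_induced p ?D ?B ?D ?P id ` carrier (?H ?D ?B) \<subseteq> carrier (?H ?D ?P)"
    by (simp add: hom_induced_carrier image_subsetI)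
  then have "inj_on (?h \<circ> hom_induced p ?D ?B ?D ?P id) (carrier (?H ?D ?B))"
    by (intro comp_inj_on inj_on_hom_induced_disc_punctured inj_on_subset[OF inj_h])
  moreover have "?h \<circ> hom_induced p ?D ?B ?D ?P id = hom_induced p ?D ?B Y ?Q (f \<circ> id)"
  proof (rule hom_induced_compose[symmetric])
    have "?B = {} \<or> ?B \<subseteq> ?P"
      by (cases "n = 0") (auto simp: disc_boundary_def)
    then show "id \<in> ?B \<rightarrow> ?P" by auto
    show "f \<in> ?P \<rightarrow> ?Q" using fP by (simp only: image_subset_iff_funcset)
  qed (simp_all add: cont)
  ultimately show ?thesis by simp
qed

subsection \<open>Linear combinations in abelian groups\<close>

text \<open>The homomorphism from integer chains to \<open>G\<close> with prescribed values on the
  generators in \<open>A\<close>; coefficients outside \<open>A\<close> are ignored. The shape is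
  that of the products in \<open>cellular_boundary\<close>.\<close>

definition finite_combination :: "('b, 'm) monoid_scheme \<Rightarrow> ('c \<Rightarrow> 'b) \<Rightarrow> 'c set \<Rightarrow> ('c \<Rightarrow>\<^sub>0 int) \<Rightarrow> 'b" where
  "finite_combination G g A x = finprod G (\<lambda>a. g a [^]\<^bsub>G\<^esub> Poly_Mapping.lookup x a) A"

lemma finite_combination_hom:
  fixes g :: "'c \<Rightarrow> 'b"
  assumes "comm_group G" and g: "g \<in> A \<rightarrow> carrier G"
  shows "finite_combination G g A \<in> hom (free_Abelian_group S) G"
proof -
  interpret comm_group G by fact
  have g': "g a \<in> carrier G" if "a \<in> A" for a
    using g that by blast
  show ?thesis
  proof (rule homI)
    fix x y :: "'c \<Rightarrow>\<^sub>0 int"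
    have "finprod G (\<lambda>a. g a [^]\<^bsub>G\<^esub> (Poly_Mapping.lookup x a + Poly_Mapping.lookup y a)) A
      = finprod G (\<lambda>a. g a [^]\<^bsub>G\<^esub> Poly_Mapping.lookup x a \<otimes>\<^bsub>G\<^esub> g a [^]\<^bsub>G\<^esub> Poly_Mapping.lookup y a) A"
      by (intro finprod_cong) (auto simp: g' int_pow_mult simp_implies_def)
    also have "\<dots> = finite_combination G g A x \<otimes>\<^bsub>G\<^esub> finite_combination G g A y"
      unfolding finite_combination_def by (intro finprod_multf) (auto simp: g')
    finally show "finite_combination G g A (x \<otimes>\<^bsub>free_Abelian_group S\<^esub> y)
        = finite_combination G g A x \<otimes>\<^bsub>G\<^esub> finite_combination G g A y"
      by (simp add: finite_combination_def lookup_add)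
  qed (auto simp: finite_combination_def g')
qed

lemma finite_combination_frag_of:
  assumes "comm_group G" "g \<in> A \<rightarrow> carrier G" "finite A" "a \<in> A"
  shows "finite_combination G g A (frag_of a) = g a"
proof -
  interpret comm_group G by fact
  have "finprod G (\<lambda>b. g b [^]\<^bsub>G\<^esub> Poly_Mapping.lookup (frag_of a) b) A = finprod G (\<lambda>b. if a = b then g b else \<one>\<^bsub>G\<^esub>) A"
    using assms(2) by (intro finprod_cong) (auto simp: simp_implies_def Pi_iff lookup_single when_def)
  then show ?thesis
    using assms by (simp add: finite_combination_def finprod_singleton)
qed

text \<open>The uniqueness half of the universal property of free abelian groups: identities between
  homomorphisms on chains need checking on single cells only.\<close>

lemma hom_free_Abelian_group_eqI:
  assumes h: "h \<in> hom (free_Abelian_group S) H" and h': "h' \<in> hom (free_Abelian_group S) H" and H: "group H"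
    and eq: "\<And>s. s \<in> S \<Longrightarrow> h (frag_of s) = h' (frag_of s)" and x: "Poly_Mapping.keys x \<subseteq> S"
  shows "h x = h' x"
proof -
  interpret h: group_hom "free_Abelian_group S" H h
    using h H by (simp add: group_hom_def group_hom_axioms_def)
  interpret h': group_hom "free_Abelian_group S" H h'
    using h' H by (simp add: group_hom_def group_hom_axioms_def)
  from x show ?thesis
  proof (induction rule: free_Abelian_group_induct [consumes 1, case_names zero diff of])
    case zero
    show ?case using h.hom_one h'.hom_one by simp
  next
    case (diff x y)
    \<comment> \<open>The induction principle builds chains from generators by differences, so
      compatibility with subtraction is required.\<close>
    have minus: "f (x - y) = f x \<otimes>\<^bsub>H\<^esub> inv\<^bsub>H\<^esub> f y" if "group_hom (free_Abelian_group S) H f" for f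
    proof -
      interpret f: group_hom "free_Abelian_group S" H f by fact
      show ?thesis
        using f.hom_mult[of x "- y"] f.hom_inv[of y] diff(1,2) by simp
    qed
    then show ?case
      unfolding minus[OF h.group_hom_axioms] minus[OF h'.group_hom_axioms] by (simp add: diff(3,4))
  next
    case (of a)
    then show ?case by (rule eq)
  qed
qed

lemma frag_extend_hom:
  assumes "\<And>s. s \<in> S \<Longrightarrow> Poly_Mapping.keys (b s) \<subseteq> T"
  shows "frag_extend b \<in> hom (free_Abelian_group S) (free_Abelian_group T)"
proof (rule homI)
  fix x assume "x \<in> carrier (free_Abelian_group S)"
  then show "frag_extend b x \<in> carrier (free_Abelian_group T)"
    using keys_frag_extend[of b x] assms by fastforce
qed (simp add: frag_extend_add)

section \<open>Consecutive maps in the long exact sequence of a pair\<close>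

lemma hom_boundary_hom_induced_eq_one:
  assumes "x \<in> carrier (homology_group p X)"
  shows "hom_boundary p X S (hom_induced p X {} X S id x) = \<one>\<^bsub>homology_group (p-1) (subtopology X S)\<^esub>"
  using homology_exactness_axiom_1[of p X S] assms by (auto simp: kernel_def)

lemma hom_induced_hom_boundary_eq_one:
  assumes "x \<in> carrier (relative_homology_group p X S)"
  shows "hom_induced (p-1) (subtopology X S) {} X {} id (hom_boundary p X S x) = \<one>\<^bsub>homology_group (p-1) X\<^esub>"
  using homology_exactness_axiom_2[of p X S] assms by (auto simp: kernel_def)

text \<open>Each relative boundary is a connecting map followed by passage to a relative group. In
  the double composite the two inner maps are consecutive in the exact sequence of the pair
  (\<open>?Y\<close>, \<open>T\<close>).\<close>

lemma hom_relboundary_hom_relboundary: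
  "hom_relboundary (p-1) (subtopology X S) T U (hom_relboundary p X S T x)
     = \<one>\<^bsub>relative_homology_group (p-2) (subtopology (subtopology X S) T) U\<^esub>"
proof -
  let ?Y = "subtopology X S" and ?Z = "subtopology (subtopology X S) T"
  have "hom_boundary (p-1) ?Y T (hom_induced (p-1) ?Y {} ?Y T id (hom_boundary p X S x)) = \<one>\<^bsub>homology_group (p-1-1) ?Z\<^esub>"
    by (rule hom_boundary_hom_induced_eq_one[OF hom_boundary_carrier])
  then show ?thesis
    using hom_one[OF hom_induced_hom[of "p-2" ?Z "{}" ?Z U id]]
    by (simp add: hom_relboundary_def)
qed

subsection \<open>Cell classes and the square of the cellular boundary\<close>

locale finite_cw =
  fixes \<Sigma> :: "('a, 'c) cw_complex"
  assumes cw: "finite_cw_complex \<Sigma>"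
begin

abbreviation "X \<equiv> cw_space \<Sigma>"
abbreviation "sk \<equiv> skeleton \<Sigma>"
abbreviation "skel_top k \<equiv> subtopology X (sk k)"

lemma Hausdorff: "Hausdorff_space X" and finite_cells: "finite (cw_cells \<Sigma>)"
  and cell_dim_ge: "c \<in> cw_cells \<Sigma> \<Longrightarrow> -1 \<le> cw_dim \<Sigma> c"
  and ex1_empty_cell: "\<exists>!c. c \<in> cells_of_dim \<Sigma> (-1)"
proof -
  have *: "\<forall>c \<in> cw_cells \<Sigma>. -1 \<le> cw_dim \<Sigma> c"
    using cw unfolding finite_cw_complex_def by (elim conjE)
  show "Hausdorff_space X" "finite (cw_cells \<Sigma>)" "\<exists>!c. c \<in> cells_of_dim \<Sigma> (-1)"
    by (insert cw, unfold finite_cw_complex_def, elim conjE, assumption)+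
  show "c \<in> cw_cells \<Sigma> \<Longrightarrow> -1 \<le> cw_dim \<Sigma> c"
    using * by (rule bspec)
qed

lemma topspace_eq_skeleton: "topspace X = (\<Union>c \<in> {c \<in> cw_cells \<Sigma>. 0 \<le> cw_dim \<Sigma> c}. open_cell \<Sigma> c)"
  using cw unfolding finite_cw_complex_def by (elim conjE)

lemma finite_cells_of_dim: "finite (cells_of_dim \<Sigma> k)"
  by (simp add: cells_of_dim_def finite_cells)

lemma cells_of_dim_empty: "k < -1 \<Longrightarrow> cells_of_dim \<Sigma> k = {}"
  using cell_dim_ge by (fastforce simp: cells_of_dim_def)

lemma disjoint_open_cells:
  assumes "c \<in> cw_cells \<Sigma>" "c' \<in> cw_cells \<Sigma>" "0 \<le> cw_dim \<Sigma> c" "0 \<le> cw_dim \<Sigma> c'" "c \<noteq> c'"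
  shows "open_cell \<Sigma> c \<inter> open_cell \<Sigma> c' = {}"
proof -
  have "\<forall>c \<in> cw_cells \<Sigma>. \<forall>c' \<in> cw_cells \<Sigma>.
        0 \<le> cw_dim \<Sigma> c \<longrightarrow> 0 \<le> cw_dim \<Sigma> c' \<longrightarrow> c \<noteq> c' \<longrightarrow>
        open_cell \<Sigma> c \<inter> open_cell \<Sigma> c' = {}"
    using cw unfolding finite_cw_complex_def by (elim conjE)
  with assms show ?thesis by simp
qed

lemma
  assumes "c \<in> cw_cells \<Sigma>" "0 \<le> cw_dim \<Sigma> c"
  shows continuous_cw_map: "continuous_map (disc (nat (cw_dim \<Sigma> c))) X (cw_map \<Sigma> c)"
    and homeomorphic_cw_map: "homeomorphic_map (subtopology (disc (nat (cw_dim \<Sigma> c))) (disc_interior (nat (cw_dim \<Sigma> c))))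
            (subtopology X (open_cell \<Sigma> c)) (cw_map \<Sigma> c)"
    and cw_map_disc_boundary: "cw_map \<Sigma> c ` disc_boundary (nat (cw_dim \<Sigma> c)) \<subseteq> sk (cw_dim \<Sigma> c - 1)"
proof -
  have "\<forall>c \<in> cw_cells \<Sigma>. 0 \<le> cw_dim \<Sigma> c \<longrightarrow>
        (let n = nat (cw_dim \<Sigma> c) in
          continuous_map (disc n) X (cw_map \<Sigma> c) \<and>
          homeomorphic_map (subtopology (disc n) (disc_interior n))
            (subtopology X (open_cell \<Sigma> c)) (cw_map \<Sigma> c) \<and>
          cw_map \<Sigma> c ` disc_boundary n \<subseteq> sk (cw_dim \<Sigma> c - 1))"
    using cw unfolding finite_cw_complex_def by (elim conjE)
  from this[rule_format, OF assms]
  show "continuous_map (disc (nat (cw_dim \<Sigma> c))) X (cw_map \<Sigma> c)"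
    and "homeomorphic_map (subtopology (disc (nat (cw_dim \<Sigma> c))) (disc_interior (nat (cw_dim \<Sigma> c))))
            (subtopology X (open_cell \<Sigma> c)) (cw_map \<Sigma> c)"
    and "cw_map \<Sigma> c ` disc_boundary (nat (cw_dim \<Sigma> c)) \<subseteq> sk (cw_dim \<Sigma> c - 1)"
    by (simp_all only: Let_def)
qed

lemma
  assumes "c \<in> cw_cells \<Sigma>"
  defines "G \<equiv> relative_homology_group (int (nat (cw_dim \<Sigma> c))) (disc (nat (cw_dim \<Sigma> c))) (disc_boundary (nat (cw_dim \<Sigma> c)))"
  shows cw_orient_carrier: "cw_orient \<Sigma> c \<in> carrier G"
    and generate_cw_orient: "generate G {cw_orient \<Sigma> c} = carrier G"
proof -
  have "\<forall>c \<in> cw_cells \<Sigma>.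
        (let n = nat (cw_dim \<Sigma> c);
             G = relative_homology_group (int n) (disc n) (disc_boundary n)
         in cw_orient \<Sigma> c \<in> carrier G \<and> generate G {cw_orient \<Sigma> c} = carrier G)"
    using cw unfolding finite_cw_complex_def by (elim conjE)
  from this[rule_format, OF assms(1)]
  show "cw_orient \<Sigma> c \<in> carrier G" and "generate G {cw_orient \<Sigma> c} = carrier G"
    by (simp_all only: Let_def G_def)
qed

section \<open>Skeleta and open cells as subspaces\<close>

lemma skeleton_mono: "k \<le> l \<Longrightarrow> sk k \<subseteq> sk l"
  by (fastforce simp: skeleton_def)

lemma skeleton_neg: "k < 0 \<Longrightarrow> sk k = {}"
  by (auto simp: skeleton_def)

lemma subtopology_skel_top: "k \<le> l \<Longrightarrow> subtopology (skel_top l) (sk k) = skel_top k"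
  by (simp add: subtopology_subtopology skeleton_mono Int_absorb1)

lemma skeleton_subset_topspace: "sk k \<subseteq> topspace X"
  by (auto simp: topspace_eq_skeleton skeleton_def)

lemma cw_map_disc:
  "cw_map \<Sigma> c ` topspace (disc (nat (cw_dim \<Sigma> c))) =
     open_cell \<Sigma> c \<union> cw_map \<Sigma> c ` disc_boundary (nat (cw_dim \<Sigma> c))"
proof -
  have "topspace (disc n) = disc_interior n \<union> disc_boundary n" for n
    by (auto simp: disc_boundary_conv_interior disc_interior_def)
  then show ?thesis
    by (simp add: open_cell_def image_Un)
qed

text \<open>If the family absorbs the boundaries of its cells, the union of open cells equals the
  union of closed cells. These are finitely many compact images, hence closed in a Hausdorff
  space.\<close>

lemma closedin_Union_open_cells:
  assumes C: "C \<subseteq> {c \<in> cw_cells \<Sigma>. 0 \<le> cw_dim \<Sigma> c}"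
    and sub: "\<And>c. c \<in> C \<Longrightarrow> sk (cw_dim \<Sigma> c - 1) \<subseteq> (\<Union>c\<in>C. open_cell \<Sigma> c)"
  shows "closedin X (\<Union>c\<in>C. open_cell \<Sigma> c)"
proof -
  have "(\<Union>c\<in>C. open_cell \<Sigma> c) = (\<Union>c\<in>C. cw_map \<Sigma> c ` topspace (disc (nat (cw_dim \<Sigma> c))))"
  proof (intro equalityI UN_least)
    fix c assume c: "c \<in> C"
    show "open_cell \<Sigma> c \<subseteq> (\<Union>c\<in>C. cw_map \<Sigma> c ` topspace (disc (nat (cw_dim \<Sigma> c))))"
      by (rule SUP_upper2[OF c]) (simp add: cw_map_disc)
    have bdry: "cw_map \<Sigma> c ` disc_boundary (nat (cw_dim \<Sigma> c)) \<subseteq> (\<Union>c\<in>C. open_cell \<Sigma> c)"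
      using subset_trans[OF cw_map_disc_boundary sub[OF c]] c C by auto
    show "cw_map \<Sigma> c ` topspace (disc (nat (cw_dim \<Sigma> c))) \<subseteq> (\<Union>c\<in>C. open_cell \<Sigma> c)"
      unfolding cw_map_disc by (intro Un_least UN_upper[OF c] bdry)
  qed
  also have "closedin X \<dots>"
  proof (rule closedin_Union)
    show "finite ((\<lambda>c. cw_map \<Sigma> c ` topspace (disc (nat (cw_dim \<Sigma> c)))) ` C)"
      using C finite_cells by (intro finite_imageI) (auto intro: finite_subset)
    fix S assume "S \<in> (\<lambda>c. cw_map \<Sigma> c ` topspace (disc (nat (cw_dim \<Sigma> c)))) ` C"
    then obtain c where c: "c \<in> C" and S: "S = cw_map \<Sigma> c ` topspace (disc (nat (cw_dim \<Sigma> c)))"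
      by blast
    have "compactin (disc (nat (cw_dim \<Sigma> c))) (topspace (disc (nat (cw_dim \<Sigma> c))))"
      using compact_space_disc by (simp add: compact_space_def)
    then show "closedin X S"
      using c C unfolding S
      by (intro compactin_imp_closedin[OF Hausdorff] image_compactin[OF _ continuous_cw_map]) auto
  qed
  finally show ?thesis .
qed

lemma open_cell_subset_skeleton: "c \<in> cells_of_dim \<Sigma> k \<Longrightarrow> 0 \<le> k \<Longrightarrow> open_cell \<Sigma> c \<subseteq> sk k"
  by (auto simp: skeleton_def cells_of_dim_def)

lemma open_cell_disjoint_skeleton:
  assumes "c \<in> cells_of_dim \<Sigma> k" "0 \<le> k"
  shows "sk (k - 1) \<inter> open_cell \<Sigma> c = {}"
proof -
  have "open_cell \<Sigma> c' \<inter> open_cell \<Sigma> c = {}"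
    if "c' \<in> cw_cells \<Sigma>" "0 \<le> cw_dim \<Sigma> c'" "cw_dim \<Sigma> c' \<le> k - 1" for c'
    using that assms by (intro disjoint_open_cells) (auto simp: cells_of_dim_def)
  then show ?thesis
    unfolding skeleton_def by auto
qed

text \<open>The complement of a k-cell in the k-skeleton is a union of cells to which the preceding
  closedness criterion applies.\<close>

lemma openin_open_cell:
  assumes c: "c \<in> cells_of_dim \<Sigma> k" and k: "0 \<le> k"
  shows "openin (skel_top k) (open_cell \<Sigma> c)"
proof -
  define C where "C = {c' \<in> cw_cells \<Sigma>. 0 \<le> cw_dim \<Sigma> c' \<and> cw_dim \<Sigma> c' \<le> k} - {c}"
  have c': "c \<in> cw_cells \<Sigma>" "cw_dim \<Sigma> c = k"
    using c by (simp_all add: cells_of_dim_def)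
  have "insert c C = {c' \<in> cw_cells \<Sigma>. 0 \<le> cw_dim \<Sigma> c' \<and> cw_dim \<Sigma> c' \<le> k}"
    using c' k by (auto simp: C_def)
  then have sk: "sk k = open_cell \<Sigma> c \<union> (\<Union>b\<in>C. open_cell \<Sigma> b)"
    unfolding skeleton_def by (metis UN_insert)
  have "open_cell \<Sigma> c \<inter> open_cell \<Sigma> b = {}" if "b \<in> C" for b
    using that c' k by (intro disjoint_open_cells) (auto simp: C_def)
  then have disj: "open_cell \<Sigma> c \<inter> (\<Union>b\<in>C. open_cell \<Sigma> b) = {}"
    by blast
  have "closedin X (\<Union>b\<in>C. open_cell \<Sigma> b)"
  proof (rule closedin_Union_open_cells)
    show "C \<subseteq> {c \<in> cw_cells \<Sigma>. 0 \<le> cw_dim \<Sigma> c}"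
      by (auto simp: C_def)
    fix b assume "b \<in> C"
    \<comment> \<open>A cell of dimension below that of \<open>b\<close> has dimension less than
      \<open>k\<close>, so it cannot be \<open>c\<close> itself.\<close>
    then have "{a \<in> cw_cells \<Sigma>. 0 \<le> cw_dim \<Sigma> a \<and> cw_dim \<Sigma> a \<le> cw_dim \<Sigma> b - 1} \<subseteq> C"
      using c' by (auto simp: C_def)
    then show "sk (cw_dim \<Sigma> b - 1) \<subseteq> (\<Union>b\<in>C. open_cell \<Sigma> b)"
      unfolding skeleton_def by (rule UN_mono) simp
  qed
  then have "closedin (skel_top k) (\<Union>b\<in>C. open_cell \<Sigma> b)"
    by (rule closedin_subset_topspace) (simp add: sk)
  then have "openin (skel_top k) (topspace (skel_top k) - (\<Union>b\<in>C. open_cell \<Sigma> b))"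
    by (intro openin_diff openin_topspace)
  moreover have "topspace (skel_top k) = sk k"
    using skeleton_subset_topspace by (simp add: Int_absorb1)
  moreover have "sk k - (\<Union>b\<in>C. open_cell \<Sigma> b) = open_cell \<Sigma> c"
    using disj unfolding sk by blast
  ultimately show ?thesis
    by (simp only:)
qed

lemma continuous_cw_map_skeleton:
  assumes c: "c \<in> cells_of_dim \<Sigma> k" and k: "0 \<le> k"
  shows "continuous_map (disc (nat k)) (skel_top k) (cw_map \<Sigma> c)"
proof -
  have c': "c \<in> cw_cells \<Sigma>" "cw_dim \<Sigma> c = k"
    using c by (simp_all add: cells_of_dim_def)
  have "cw_map \<Sigma> c ` disc_boundary (nat k) \<subseteq> sk k"
    using cw_map_disc_boundary[of c] c' k skeleton_mono[of "k - 1" k] by simp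
  then have "cw_map \<Sigma> c ` topspace (disc (nat k)) \<subseteq> sk k"
    using cw_map_disc[of c] open_cell_subset_skeleton[OF c k] by (simp add: c')
  moreover have "continuous_map (disc (nat k)) X (cw_map \<Sigma> c)"
    using continuous_cw_map[of c] c' k by simp
  ultimately show ?thesis
    by (simp add: continuous_map_in_subtopology flip: image_subset_iff_funcset)
qed

section \<open>Cell classes in H_k(X^k, X^(k-1)) and their independence\<close>

abbreviation "chain_class k \<equiv> finite_combination (skeleton_homology \<Sigma> k) (cell_class \<Sigma>) (cells_of_dim \<Sigma> k)"

lemma comm_group_skeleton_homology: "comm_group (skeleton_homology \<Sigma> k)"
  by (simp add: skeleton_homology_def)

lemma group_skeleton_homology: "group (skeleton_homology \<Sigma> k)"
  by (simp add: skeleton_homology_def)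

lemma cell_class_carrier: "cell_class \<Sigma> \<in> cells_of_dim \<Sigma> k \<rightarrow> carrier (skeleton_homology \<Sigma> k)"
  by (auto simp: cell_class_def skeleton_homology_def Let_def hom_induced_carrier cells_of_dim_def)

lemma chain_class_frag_of: "c \<in> cells_of_dim \<Sigma> k \<Longrightarrow> chain_class k (frag_of c) = cell_class \<Sigma> c"
  by (intro finite_combination_frag_of comm_group_skeleton_homology cell_class_carrier finite_cells_of_dim)

lemma chain_class_hom: "chain_class k \<in> hom (free_Abelian_group S) (skeleton_homology \<Sigma> k)"
  by (intro finite_combination_hom comm_group_skeleton_homology cell_class_carrier)

text \<open>Restriction to the local homology of the k-skeleton at the center of \<open>c\<close>;
  it serves as a coordinate functional that isolates the cell \<open>c\<close>.\<close>

definition local_hom :: "'c \<Rightarrow> 'a chain set \<Rightarrow> 'a chain set" where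
  "local_hom c = (let k = cw_dim \<Sigma> c in hom_induced k (skel_top k) (sk (k - 1)) (skel_top k)
     (topspace (skel_top k) - {cw_map \<Sigma> c (\<lambda>_. 0)}) id)"

definition local_homology :: "'c \<Rightarrow> 'a chain set monoid" where
  "local_homology c = (let k = cw_dim \<Sigma> c in
     relative_homology_group k (skel_top k) (topspace (skel_top k) - {cw_map \<Sigma> c (\<lambda>_. 0)}))"

lemma group_local_homology: "group (local_homology c)"
  by (simp add: local_homology_def Let_def)

lemma local_hom_hom: "c \<in> cells_of_dim \<Sigma> k \<Longrightarrow> local_hom c \<in> hom (skeleton_homology \<Sigma> k) (local_homology c)"
  by (auto simp: local_hom_def skeleton_homology_def local_homology_def Let_def cells_of_dim_def hom_induced_hom)

lemma center_in_open_cell: "cw_map \<Sigma> c (\<lambda>_. 0) \<in> open_cell \<Sigma> c"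
  by (simp add: open_cell_def zero_in_disc_interior)

lemma local_hom_cell_class:
  assumes c: "c \<in> cells_of_dim \<Sigma> k" and c': "c' \<in> cells_of_dim \<Sigma> k" and k: "0 \<le> k"
  shows "local_hom c (cell_class \<Sigma> c') = hom_induced k (disc (nat k)) (disc_boundary (nat k))
     (skel_top k) (topspace (skel_top k) - {cw_map \<Sigma> c (\<lambda>_. 0)}) (cw_map \<Sigma> c') (cw_orient \<Sigma> c')"
proof -
  have dims: "cw_dim \<Sigma> c = k" "cw_dim \<Sigma> c' = k" "c' \<in> cw_cells \<Sigma>"
    using c c' by (auto simp: cells_of_dim_def)
  have "sk (k - 1) \<subseteq> topspace (skel_top k) - {cw_map \<Sigma> c (\<lambda>_. 0)}"
    using open_cell_disjoint_skeleton[OF c k] center_in_open_cell[of c] skeleton_mono[of "k-1" k]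
      skeleton_subset_topspace[of k] by auto
  then show ?thesis
    using continuous_cw_map_skeleton[OF c' k] cw_map_disc_boundary[of c'] dims k
    by (simp add: local_hom_def cell_class_def Let_def)
       (subst hom_induced_compose'; auto)
qed

text \<open>The closed cell \<open>c'\<close> misses the center of \<open>c\<close>, so its
  characteristic map factors through the pair (D, D), whose relative homology is trivial.\<close>

lemma local_hom_other_cell_class:
  assumes c: "c \<in> cells_of_dim \<Sigma> k" and c': "c' \<in> cells_of_dim \<Sigma> k" and k: "0 \<le> k" and ne: "c \<noteq> c'"
  shows "local_hom c (cell_class \<Sigma> c') = \<one>\<^bsub>local_homology c\<^esub>"
proof -
  let ?D = "disc (nat k)" and ?Q = "topspace (skel_top k) - {cw_map \<Sigma> c (\<lambda>_. 0)}"
  have dims: "cw_dim \<Sigma> c = k" "cw_dim \<Sigma> c' = k" "c \<in> cw_cells \<Sigma>" "c' \<in> cw_cells \<Sigma>"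
    using c c' by (auto simp: cells_of_dim_def)
  have "cw_map \<Sigma> c (\<lambda>_. 0) \<notin> cw_map \<Sigma> c' ` topspace ?D"
    using cw_map_disc[of c'] center_in_open_cell[of c] disjoint_open_cells[OF dims(3,4)] ne dims k
      open_cell_disjoint_skeleton[OF c k] cw_map_disc_boundary[of c'] by auto
  moreover have "cw_map \<Sigma> c' ` topspace ?D \<subseteq> topspace (skel_top k)"
    by (rule continuous_map_image_subset_topspace[OF continuous_cw_map_skeleton[OF c' k]])
  ultimately have im: "cw_map \<Sigma> c' \<in> topspace ?D \<rightarrow> ?Q"
    unfolding image_subset_iff_funcset[symmetric] by (simp only: subset_Diff_insert Diff_empty not_False_eq_True simp_thms)
  let ?x = "hom_induced k ?D (disc_boundary (nat k)) ?D (topspace ?D) id (cw_orient \<Sigma> c')"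
  have "?x = \<one>\<^bsub>relative_homology_group k ?D (topspace ?D)\<^esub>"
    using trivial_relative_homology_group_topspace[of k ?D] hom_induced_carrier[of k ?D "disc_boundary (nat k)" ?D "topspace ?D" id "cw_orient \<Sigma> c'"]
    by (auto simp: trivial_group_def)
  moreover have "local_hom c (cell_class \<Sigma> c') = hom_induced k ?D (topspace ?D) (skel_top k) ?Q (cw_map \<Sigma> c') ?x"
    using im continuous_cw_map_skeleton[OF c' k]
    by (subst local_hom_cell_class[OF c c' k], subst hom_induced_compose') (auto simp: disc_boundary_def)
  ultimately show ?thesis
    using dims hom_one[OF hom_induced_hom[of k ?D "topspace ?D" "skel_top k" ?Q "cw_map \<Sigma> c'"]]
    by (simp add: local_homology_def)
qed

text \<open>The map from H_k(D,S) to local homology is injective, so the infinite order of the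
  orientation carries over to the image of the cell class.\<close>

lemma local_hom_cell_class_int_pow:
  assumes c: "c \<in> cells_of_dim \<Sigma> k" and k: "0 \<le> k"
    and one: "local_hom c (cell_class \<Sigma> c) [^]\<^bsub>local_homology c\<^esub> (m :: int) = \<one>\<^bsub>local_homology c\<^esub>"
  shows "m = 0"
proof -
  define n where "n = nat k"
  let ?D = "disc n" and ?B = "disc_boundary n"
  let ?G = "relative_homology_group (int n) ?D ?B"
  let ?h = "hom_induced (int n) ?D ?B (skel_top k) (topspace (skel_top k) - {cw_map \<Sigma> c (\<lambda>_. 0)}) (cw_map \<Sigma> c)"
  have n: "k = int n" using k by (simp add: n_def)
  have dims: "cw_dim \<Sigma> c = k" "c \<in> cw_cells \<Sigma>" "nat (cw_dim \<Sigma> c) = n"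
    using c by (auto simp: cells_of_dim_def n_def)
  have E: "open_cell \<Sigma> c = cw_map \<Sigma> c ` disc_interior n"
    by (simp add: open_cell_def dims(3))
  have or: "cw_orient \<Sigma> c \<in> carrier ?G" "generate ?G {cw_orient \<Sigma> c} = carrier ?G"
    using cw_orient_carrier[OF dims(2)] generate_cw_orient[OF dims(2)] dims(3) by simp_all
  interpret G: group ?G by simp
  have hom: "?h \<in> hom ?G (local_homology c)"
    by (simp add: local_homology_def Let_def dims(1) n hom_induced_hom)
  \<comment> \<open>The ambient space is the k-skeleton, in which k-cells are open.\<close>
  have inj: "inj_on ?h (carrier ?G)"
  proof (rule inj_on_hom_induced_local_homology)
    show "Hausdorff_space (skel_top k)"
      by (simp add: Hausdorff Hausdorff_space_subtopology)
    show "continuous_map ?D (skel_top k) (cw_map \<Sigma> c)"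
      using continuous_cw_map_skeleton[OF c k] by (simp add: n_def)
    show "openin (skel_top k) (cw_map \<Sigma> c ` disc_interior n)"
      using openin_open_cell[OF c k] by (simp add: E)
    show "homeomorphic_map (subtopology ?D (disc_interior n))
       (subtopology (skel_top k) (cw_map \<Sigma> c ` disc_interior n)) (cw_map \<Sigma> c)"
      using homeomorphic_cw_map[OF dims(2)] k dims open_cell_subset_skeleton[OF c k]
      by (simp add: E subtopology_subtopology Int_absorb1)
    show "cw_map \<Sigma> c ` ?B \<inter> cw_map \<Sigma> c ` disc_interior n = {}"
      using cw_map_disc_boundary[OF dims(2)] open_cell_disjoint_skeleton[OF c k] k dims by (auto simp: E)
  qed
  have eq: "?h (cw_orient \<Sigma> c [^]\<^bsub>?G\<^esub> m) = ?h \<one>\<^bsub>?G\<^esub>"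
    using hom_int_pow[OF hom or(1)] one local_hom_cell_class[OF c c k] hom_one[OF hom]
    by (simp add: n group_local_homology)
  have "cw_orient \<Sigma> c [^]\<^bsub>?G\<^esub> m = \<one>\<^bsub>?G\<^esub>"
    by (rule inj_onD[OF inj eq G.int_pow_closed[OF or(1)] G.one_closed])
  with or show ?thesis
    by (rule disc_generator_int_pow_eq_one)
qed

text \<open>Injectivity on k-chains: \<open>local_hom c\<close> annihilates the classes of all other
  k-cells, so it reads off the coefficient at \<open>c\<close>.\<close>

lemma chain_class_eq_one:
  assumes x: "Poly_Mapping.keys x \<subseteq> cells_of_dim \<Sigma> k" and k: "0 \<le> k"
    and one: "chain_class k x = \<one>\<^bsub>skeleton_homology \<Sigma> k\<^esub>"
  shows "x = 0"
proof (rule poly_mapping_eqI)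
  fix c
  show "Poly_Mapping.lookup x c = Poly_Mapping.lookup 0 c"
  proof (cases "c \<in> cells_of_dim \<Sigma> k")
    case c: True
    interpret L: group "local_homology c" by (rule group_local_homology)
    let ?y = "local_hom c (cell_class \<Sigma> c)"
    have y: "?y \<in> carrier (local_homology c)"
      by (rule hom_in_carrier[OF local_hom_hom[OF c] funcset_mem[OF cell_class_carrier c]])
    have "(local_hom c \<circ> chain_class k) x = ?y [^]\<^bsub>local_homology c\<^esub> Poly_Mapping.lookup x c"
    proof (rule hom_free_Abelian_group_eqI[OF _ _ group_local_homology _ x])
      show "local_hom c \<circ> chain_class k \<in> hom (free_Abelian_group (cells_of_dim \<Sigma> k)) (local_homology c)"
        by (rule hom_compose[OF chain_class_hom local_hom_hom[OF c]])
      show "(\<lambda>x. ?y [^]\<^bsub>local_homology c\<^esub> Poly_Mapping.lookup x c)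
          \<in> hom (free_Abelian_group (cells_of_dim \<Sigma> k)) (local_homology c)"
        by (rule homI) (auto simp: y lookup_add L.int_pow_mult)
      fix c' assume c': "c' \<in> cells_of_dim \<Sigma> k"
      show "(local_hom c \<circ> chain_class k) (frag_of c')
          = ?y [^]\<^bsub>local_homology c\<^esub> Poly_Mapping.lookup (frag_of c') c"
        using local_hom_other_cell_class[OF c c' k] y
        by (cases "c = c'") (simp_all add: chain_class_frag_of[OF c'] lookup_single group.int_pow_1 group_local_homology)
    qed
    then have "?y [^]\<^bsub>local_homology c\<^esub> Poly_Mapping.lookup x c = \<one>\<^bsub>local_homology c\<^esub>"
      using hom_one[OF local_hom_hom[OF c] group_skeleton_homology group_local_homology] one by simp
    then show ?thesis
      using local_hom_cell_class_int_pow[OF c k] by simp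
  next
    case False
    then show ?thesis using x by (auto simp: in_keys_iff)
  qed
qed

section \<open>The chain group in dimension -1\<close>

abbreviation "empty_chain_class \<equiv> finite_combination (homology_group 0 (disc 0)) (cw_orient \<Sigma>) (cells_of_dim \<Sigma> (-1))"

lemma empty_cell_orient:
  assumes "c \<in> cells_of_dim \<Sigma> (-1)"
  shows "cw_orient \<Sigma> c \<in> carrier (homology_group 0 (disc 0))"
    "generate (homology_group 0 (disc 0)) {cw_orient \<Sigma> c} = carrier (homology_group 0 (disc 0))"
proof -
  have "disc_boundary 0 = {}" by (auto simp: disc_boundary_def)
  with assms cw_orient_carrier[of c] generate_cw_orient[of c] show "cw_orient \<Sigma> c \<in> carrier (homology_group 0 (disc 0))"
    "generate (homology_group 0 (disc 0)) {cw_orient \<Sigma> c} = carrier (homology_group 0 (disc 0))"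
    by (simp_all add: cells_of_dim_def)
qed

text \<open>There is a single (-1)-cell, so the combination is one power of its orientation, a
  generator of infinite order.\<close>

lemma empty_chain_class_eq_one:
  assumes x: "Poly_Mapping.keys x \<subseteq> cells_of_dim \<Sigma> (-1)"
    and one: "empty_chain_class x = \<one>\<^bsub>homology_group 0 (disc 0)\<^esub>"
  shows "x = 0"
proof -
  obtain e where e: "cells_of_dim \<Sigma> (-1) = {e}"
    using ex1_empty_cell by blast
  interpret comm_group "homology_group 0 (disc 0)" by simp
  have "cw_orient \<Sigma> e [^]\<^bsub>homology_group 0 (disc 0)\<^esub> Poly_Mapping.lookup x e = \<one>\<^bsub>homology_group 0 (disc 0)\<^esub>"
    using one empty_cell_orient(1)[of e] by (simp add: finite_combination_def e)
  moreover have "disc_boundary 0 = {}" by (auto simp: disc_boundary_def)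
  ultimately have "Poly_Mapping.lookup x e = 0"
    using disc_generator_int_pow_eq_one[of "cw_orient \<Sigma> e" 0] empty_cell_orient[of e] by (simp add: e)
  then show ?thesis
    using x e by (metis in_keys_iff keys_eq_empty subset_singletonD singletonI)
qed

text \<open>The topological boundary maps compose to zero, and injectivity of the passage from
  chains to homology classes transfers this to coefficients. Dimension 1 is separate because the
  second map is then the augmentation.\<close>

lemma boundary_squared:
  assumes bd: "cellular_boundary \<Sigma> bd" and c: "c \<in> cells_of_dim \<Sigma> k"
  shows "frag_extend bd (bd c) = 0"
proof -
  have keys: "Poly_Mapping.keys (bd c) \<subseteq> cells_of_dim \<Sigma> (l - 1)" if "c \<in> cells_of_dim \<Sigma> l" for c l
    using bd that by (auto simp: cellular_boundary_def cells_of_dim_def Let_def)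
  have relboundary: "hom_relboundary l (skel_top l) (sk (l - 1)) (sk (l - 2)) (cell_class \<Sigma> c) = chain_class (l - 1) (bd c)"
    if "c \<in> cells_of_dim \<Sigma> l" "1 \<le> l" for c l
    using bd that by (auto simp: cellular_boundary_def cells_of_dim_def Let_def finite_combination_def)
  have keys2: "Poly_Mapping.keys (frag_extend bd (bd c)) \<subseteq> cells_of_dim \<Sigma> (k - 2)"
    using keys_frag_extend[of bd "bd c"] keys[OF c] keys[of _ "k - 1"] by fastforce
  have extend: "frag_extend bd \<in> hom (free_Abelian_group (cells_of_dim \<Sigma> (k - 1))) (free_Abelian_group (cells_of_dim \<Sigma> (k - 2)))"
    using keys[of _ "k - 1"] by (intro frag_extend_hom) simp
  consider "2 \<le> k" | "k = 1" | "k \<le> 0" by linarith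
  then show ?thesis
  proof cases
    case 1
    let ?r = "hom_relboundary (k - 1) (skel_top (k - 1)) (sk (k - 2)) (sk (k - 3))"
    have r: "?r \<in> hom (skeleton_homology \<Sigma> (k - 1)) (skeleton_homology \<Sigma> (k - 2))"
      using group_homomorphism_hom_relboundary[of "k - 1" "skel_top (k - 1)" "sk (k - 2)" "sk (k - 3)"]
      by (simp add: skeleton_homology_def subtopology_skel_top)
    \<comment> \<open>The coefficient map \<open>bd\<close> and the relative boundary
      \<open>?r\<close> correspond under \<open>chain_class\<close>; this is checked on single
      (k-1)-cells.\<close>
    have "(chain_class (k - 2) \<circ> frag_extend bd) (bd c) = (?r \<circ> chain_class (k - 1)) (bd c)"
    proof (rule hom_free_Abelian_group_eqI[OF _ _ group_skeleton_homology _ keys[OF c]])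
      show "chain_class (k - 2) \<circ> frag_extend bd \<in> hom (free_Abelian_group (cells_of_dim \<Sigma> (k - 1))) (skeleton_homology \<Sigma> (k - 2))"
        by (rule hom_compose[OF extend chain_class_hom])
      show "?r \<circ> chain_class (k - 1) \<in> hom (free_Abelian_group (cells_of_dim \<Sigma> (k - 1))) (skeleton_homology \<Sigma> (k - 2))"
        by (rule hom_compose[OF chain_class_hom r])
      fix c' assume "c' \<in> cells_of_dim \<Sigma> (k - 1)"
      then show "(chain_class (k - 2) \<circ> frag_extend bd) (frag_of c') = (?r \<circ> chain_class (k - 1)) (frag_of c')"
        using relboundary[of c' "k - 1"] 1 by (simp add: chain_class_frag_of)
    qed
    also have "\<dots> = ?r (hom_relboundary k (skel_top k) (sk (k - 1)) (sk (k - 2)) (cell_class \<Sigma> c))"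
      using relboundary[OF c] 1 by simp
    also have "\<dots> = \<one>\<^bsub>skeleton_homology \<Sigma> (k - 2)\<^esub>"
      using hom_relboundary_hom_relboundary[of k "skel_top k" "sk (k - 1)" "sk (k - 2)" "sk (k - 3)"]
      by (simp add: subtopology_skel_top skeleton_homology_def)
    finally show ?thesis
      using chain_class_eq_one[OF keys2] 1 by simp
  next
    case 2
    let ?Z = "\<lambda>_ _. 0 :: real"
    let ?a = "hom_induced 0 (skel_top 0) {} (disc 0) {} ?Z"
    have cont: "continuous_map Y (disc 0) ?Z" for Y :: "'a topology"
      using zero_in_disc_interior[of 0] by (auto simp: disc_interior_def)
    have aug: "?a (cell_class \<Sigma> c') = empty_chain_class (bd c')" if "c' \<in> cells_of_dim \<Sigma> 0" for c'
      using bd that by (auto simp: cellular_boundary_def cells_of_dim_def Let_def finite_combination_def)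
    have orient: "cw_orient \<Sigma> \<in> cells_of_dim \<Sigma> (-1) \<rightarrow> carrier (homology_group 0 (disc 0))"
      using empty_cell_orient(1) by blast
    have "(empty_chain_class \<circ> frag_extend bd) (bd c) = (?a \<circ> chain_class 0) (bd c)"
    proof (rule hom_free_Abelian_group_eqI)
      show "Poly_Mapping.keys (bd c) \<subseteq> cells_of_dim \<Sigma> 0"
        using keys[OF c] 2 by simp
      show "empty_chain_class \<circ> frag_extend bd \<in> hom (free_Abelian_group (cells_of_dim \<Sigma> 0)) (homology_group 0 (disc 0))"
        using hom_compose[OF extend finite_combination_hom[OF abelian_homology_group orient]] 2 by simp
      show "?a \<circ> chain_class 0 \<in> hom (free_Abelian_group (cells_of_dim \<Sigma> 0)) (homology_group 0 (disc 0))"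
      proof (rule hom_compose[OF chain_class_hom])
        show "?a \<in> hom (skeleton_homology \<Sigma> 0) (homology_group 0 (disc 0))"
          by (simp add: skeleton_homology_def skeleton_neg hom_induced_empty_hom)
      qed
      fix c' assume "c' \<in> cells_of_dim \<Sigma> 0"
      then show "(empty_chain_class \<circ> frag_extend bd) (frag_of c') = (?a \<circ> chain_class 0) (frag_of c')"
        using aug[of c'] by (simp add: chain_class_frag_of)
    qed simp
    also have "\<dots> = ?a (hom_boundary 1 (skel_top 1) (sk 0) (cell_class \<Sigma> c))"
      using relboundary[OF c] 2 by (simp add: skeleton_neg hom_relboundary_empty)
    \<comment> \<open>The map to the point factors through the 1-skeleton, where the boundary of a
      relative 1-class becomes trivial by exactness.\<close>
    also have "\<dots> = hom_induced 0 (skel_top 1) {} (disc 0) {} ?Z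
        (hom_induced 0 (skel_top 0) {} (skel_top 1) {} id (hom_boundary 1 (skel_top 1) (sk 0) (cell_class \<Sigma> c)))"
    proof -
      have "continuous_map (skel_top 0) (skel_top 1) id"
        using skeleton_mono[of 0 1] by (auto simp: continuous_map_in_subtopology)
      from hom_induced_compose'[OF this _ cont, of "{}" "{}" "{}"] show ?thesis
        by (simp add: comp_def)
    qed
    also have "\<dots> = \<one>\<^bsub>homology_group 0 (disc 0)\<^esub>"
    proof -
      have "cell_class \<Sigma> c \<in> carrier (relative_homology_group 1 (skel_top 1) (sk 0))"
        using cell_class_carrier[of 1] c 2 by (auto simp: skeleton_homology_def)
      from hom_induced_hom_boundary_eq_one[OF this] show ?thesis
        using hom_one[OF hom_induced_empty_hom[of 0 "skel_top 1" "disc 0" ?Z]]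
        by (simp add: subtopology_skel_top)
    qed
    finally show ?thesis
      using empty_chain_class_eq_one[of "frag_extend bd (bd c)"] keys2 2 by simp
  next
    case 3
    \<comment> \<open>The boundary of \<open>c'\<close> is supported on cells of dimension k-2 < -1,
      of which there are none.\<close>
    have "bd c' = 0" if "c' \<in> Poly_Mapping.keys (bd c)" for c'
      using keys[of c' "k - 1"] keys[OF c] that 3 by (auto simp: cells_of_dim_empty)
    then show ?thesis by (simp add: frag_extend_eq_0)
  qed
qed

end

subsection \<open>Flows, circuits and the integral basis\<close>

text \<open>Restricting coefficients to \<open>S\<close> is injective on \<open>L\<close> and sends
  the vectors \<open>w s\<close> to signed unit vectors, so coordinates can be read off over the
  integers.\<close>

lemma integral_basis_triangular:
  fixes w :: "'c \<Rightarrow> ('c \<Rightarrow>\<^sub>0 int)" and \<epsilon> :: "'c \<Rightarrow> int"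
  assumes S: "finite S"
    and L: "\<And>x y. x \<in> L \<Longrightarrow> y \<in> L \<Longrightarrow> x + y \<in> L" "\<And>m x. x \<in> L \<Longrightarrow> frag_cmul m x \<in> L" "0 \<in> L"
    and w: "\<And>s. s \<in> S \<Longrightarrow> w s \<in> L"
    and diag: "\<And>s. s \<in> S \<Longrightarrow> \<epsilon> s * \<epsilon> s = 1"
    and coeff: "\<And>s t. s \<in> S \<Longrightarrow> t \<in> S \<Longrightarrow> Poly_Mapping.lookup (w s) t = (if s = t then \<epsilon> s else 0)"
    and zero: "\<And>x. x \<in> L \<Longrightarrow> (\<And>s. s \<in> S \<Longrightarrow> Poly_Mapping.lookup x s = 0) \<Longrightarrow> x = 0"
  shows "integral_basis L (w ` S)"
proof -
  \<comment> \<open>\<open>integral_basis\<close> speaks of a set of vectors; injectivity turns sums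
    over that set into sums over the index set \<open>S\<close>.\<close>
  have inj: "inj_on w S"
  proof (rule inj_onI, rule ccontr)
    fix s t assume st: "s \<in> S" "t \<in> S" "w s = w t" "s \<noteq> t"
    then have "\<epsilon> s = 0"
      using coeff[of s s] coeff[of t s] by simp
    then show False using diag[of s] st by simp
  qed
  have sum_image: "(\<Sum>b\<in>w ` S. frag_cmul (a b) b) = (\<Sum>s\<in>S. frag_cmul (a (w s)) (w s))" for a
    using inj by (simp add: sum.reindex)
  have lookup_sum: "Poly_Mapping.lookup (\<Sum>s\<in>S. frag_cmul (a s) (w s)) t = a t * \<epsilon> t" if "t \<in> S" for a t
  proof -
    have "Poly_Mapping.lookup (\<Sum>s\<in>S. frag_cmul (a s) (w s)) t = (\<Sum>s\<in>S. a s * Poly_Mapping.lookup (w s) t)"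
      by (simp add: lookup_sum)
    also have "\<dots> = (\<Sum>s\<in>S. if s = t then a t * \<epsilon> t else 0)"
      using that by (intro sum.cong) (auto simp: coeff)
    finally show ?thesis
      using S that by simp
  qed
  have sum_L: "(\<Sum>s\<in>T. frag_cmul (a s) (w s)) \<in> L" if "T \<subseteq> S" for a T
    using finite_subset[OF that S] that
    by (induction T rule: finite_induct) (auto intro!: L w)
  \<comment> \<open>As \<open>\<epsilon> s\<close> is its own inverse, these coefficients reproduce
    \<open>x\<close> on \<open>S\<close>; the difference lies in \<open>L\<close> and vanishes on
    \<open>S\<close>, hence is 0.\<close>
  have expand: "x = (\<Sum>s\<in>S. frag_cmul (Poly_Mapping.lookup x s * \<epsilon> s) (w s))" (is "x = ?y") if "x \<in> L" for x
  proof -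
    have "x + frag_cmul (-1) ?y = 0"
    proof (rule zero)
      show "x + frag_cmul (-1) ?y \<in> L"
        by (intro L that sum_L order_refl)
      fix s assume "s \<in> S"
      then show "Poly_Mapping.lookup (x + frag_cmul (-1) ?y) s = 0"
        using diag by (simp only: lookup_add lookup_frag_cmul lookup_sum mult.assoc)
    qed
    then show ?thesis by simp
  qed
  have reindex: "(\<Sum>s\<in>S. frag_cmul (a s) (w s)) = (\<Sum>b\<in>w ` S. frag_cmul (a (the_inv_into S w b)) b)" for a
    unfolding sum_image by (intro sum.cong) (simp_all add: the_inv_into_f_f[OF inj])
  have "L \<subseteq> range (\<lambda>a. \<Sum>b\<in>w ` S. frag_cmul (a b) b)"
  proof
    fix x assume "x \<in> L"
    let ?a = "\<lambda>b. Poly_Mapping.lookup x (the_inv_into S w b) * \<epsilon> (the_inv_into S w b)"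
    have "x = (\<Sum>b\<in>w ` S. frag_cmul (?a b) b)"
      by (rule trans[OF expand[OF \<open>x \<in> L\<close>] reindex])
    show "x \<in> range (\<lambda>a. \<Sum>b\<in>w ` S. frag_cmul (a b) b)"
      by (rule range_eqI[where x = ?a]) fact
  qed
  moreover have "range (\<lambda>a. \<Sum>b\<in>w ` S. frag_cmul (a b) b) \<subseteq> L"
    by (intro image_subsetI) (simp only: sum_image, rule sum_L[OF order_refl])
  moreover have "a (w s) = 0" if "(\<Sum>b\<in>w ` S. frag_cmul (a b) b) = 0" "s \<in> S" for a s
  proof -
    have "a (w s) * \<epsilon> s = 0"
      using lookup_sum[of s "\<lambda>s. a (w s)"] that by (simp add: sum_image)
    then have "a (w s) * (\<epsilon> s * \<epsilon> s) = 0" by simp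
    then show ?thesis using diag[OF that(2)] by simp
  qed
  ultimately show ?thesis
    unfolding integral_basis_def using S by (intro conjI allI impI ballI) auto
qed

section \<open>Cellular cycles and homology classes\<close>

lemma cellular_cycles_iff:
  "x \<in> cellular_cycles \<Sigma> bd K k \<longleftrightarrow> Poly_Mapping.keys x \<subseteq> {c \<in> K. cw_dim \<Sigma> c = k} \<and> frag_extend bd x = 0"
  by (auto simp: cellular_cycles_def kernel_def cellular_chains_def)

lemma subgroup_cellular_cycles:
  assumes "\<And>c. c \<in> K \<Longrightarrow> cw_dim \<Sigma> c = k \<Longrightarrow> Poly_Mapping.keys (bd c) \<subseteq> {c \<in> K. cw_dim \<Sigma> c = k - 1}"
  shows "subgroup (cellular_cycles \<Sigma> bd K k) (cellular_chains \<Sigma> K k)"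
proof -
  interpret group_hom "cellular_chains \<Sigma> K k" "cellular_chains \<Sigma> K (k - 1)" "frag_extend bd"
    unfolding group_hom_def group_hom_axioms_def cellular_chains_def
    using frag_extend_hom[of "{c \<in> K. cw_dim \<Sigma> c = k}" bd "{c \<in> K. cw_dim \<Sigma> c = k - 1}"] assms by simp
  show ?thesis
    unfolding cellular_cycles_def by (rule subgroup_kernel)
qed

text \<open>\<open>cellular_homology\<close> is built on the subgroup generated by the cycles; since
  the cycles already form a subgroup, its elements are exactly the cosets of cycles.\<close>

lemma homology_class_in_cellular_homology:
  assumes "subgroup (cellular_cycles \<Sigma> bd K k) (cellular_chains \<Sigma> K k)" "z \<in> cellular_cycles \<Sigma> bd K k"
  shows "homology_class \<Sigma> bd K k z \<in> carrier (cellular_homology \<Sigma> bd K k)"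
proof -
  interpret subgroup "cellular_cycles \<Sigma> bd K k" "cellular_chains \<Sigma> K k" by fact
  have "carrier (subgroup_generated (cellular_chains \<Sigma> K k) (cellular_cycles \<Sigma> bd K k)) = cellular_cycles \<Sigma> bd K k"
    by (simp add: carrier_subgroup_generated_subgroup)
  then show ?thesis
    using assms(2)
    by (auto simp: cellular_homology_def FactGroup_def RCOSETS_def homology_class_def r_coset_def)
qed

lemma homology_class_eq_iff:
  "homology_class \<Sigma> bd K k z = homology_class \<Sigma> bd K k z' \<longleftrightarrow> z - z' \<in> cellular_boundaries \<Sigma> bd K k"
proof -
  let ?B = "cellular_boundaries \<Sigma> bd K k"
  interpret group "cellular_chains \<Sigma> K (k + 1)"
    by (simp add: cellular_chains_def)
  have add: "x + y \<in> ?B" if "x \<in> ?B" "y \<in> ?B" for x y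
  proof -
    obtain u v where uv: "u \<in> carrier (cellular_chains \<Sigma> K (k + 1))" "v \<in> carrier (cellular_chains \<Sigma> K (k + 1))"
      "x = frag_extend bd u" "y = frag_extend bd v"
      using \<open>x \<in> ?B\<close> \<open>y \<in> ?B\<close> by (auto simp only: cellular_boundaries_def image_iff Bex_def)
    then have "x + y = frag_extend bd (u + v)" "u + v \<in> carrier (cellular_chains \<Sigma> K (k + 1))"
      using m_closed[OF uv(1,2)] by (simp_all add: frag_extend_add cellular_chains_def)
    then show ?thesis
      unfolding cellular_boundaries_def by blast
  qed
  have minus: "- x \<in> ?B" if "x \<in> ?B" for x
  proof -
    obtain u where u: "u \<in> carrier (cellular_chains \<Sigma> K (k + 1))" "x = frag_extend bd u"
      using \<open>x \<in> ?B\<close> by (auto simp only: cellular_boundaries_def image_iff Bex_def)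
    show ?thesis
      unfolding cellular_boundaries_def
    proof (rule image_eqI)
      show "- x = frag_extend bd (- u)"
        unfolding u(2) by (rule frag_extend_minus[symmetric])
      show "- u \<in> carrier (cellular_chains \<Sigma> K (k + 1))"
        using u(1) by (simp only: cellular_chains_def carrier_free_Abelian_group_iff keys_minus)
    qed
  qed
  have zero: "0 \<in> ?B"
    unfolding cellular_boundaries_def
    by (rule image_eqI[of _ _ 0]) (simp_all add: cellular_chains_def)
  have eq: "homology_class \<Sigma> bd K k x = (\<lambda>b. b + x) ` ?B" for x
    by (auto simp: homology_class_def r_coset_def cellular_chains_def)
  show ?thesis
  proof
    assume "homology_class \<Sigma> bd K k z = homology_class \<Sigma> bd K k z'"
    moreover have "z \<in> homology_class \<Sigma> bd K k z"
      unfolding eq using zero by force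
    ultimately obtain b where "b \<in> ?B" "z = b + z'"
      unfolding eq by blast
    then show "z - z' \<in> ?B" by simp
  next
    assume d: "z - z' \<in> ?B"
    have "b + z \<in> (\<lambda>b. b + z') ` ?B" if "b \<in> ?B" for b
      using add[OF that d] by (intro image_eqI[of _ _ "b + (z - z')"]) simp_all
    moreover have "b + z' \<in> (\<lambda>b. b + z) ` ?B" if "b \<in> ?B" for b
      using add[OF that minus[OF d]] by (intro image_eqI[of _ _ "b + - (z - z')"]) simp_all
    ultimately show "homology_class \<Sigma> bd K k z = homology_class \<Sigma> bd K k z'"
      unfolding eq by blast
  qed
qed

text \<open>The homology hypothesis enters here: \<open>bd \<sigma>\<close> and 0 have the same
  class in the whole complex, and injectivity of the induced map brings this equality back to the
  forest.\<close>

lemma (in finite_cw) facet_boundary_in_forest_boundaries: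
  assumes bd: "cellular_boundary \<Sigma> bd" and \<Upsilon>: "\<Upsilon> \<subseteq> facets \<Sigma>" and \<sigma>: "\<sigma> \<in> facets \<Sigma>"
    and iso: "inclusion_induces_iso \<Sigma> bd (spanning_subcomplex \<Sigma> \<Upsilon>) (cw_cells \<Sigma>) (cw_dimension \<Sigma> - 1)"
  obtains y where "Poly_Mapping.keys y \<subseteq> \<Upsilon>" "bd \<sigma> = frag_extend bd y"
proof -
  define d where "d = cw_dimension \<Sigma>"
  define K where "K = spanning_subcomplex \<Sigma> \<Upsilon>"
  have \<sigma>': "\<sigma> \<in> cells_of_dim \<Sigma> d"
    using \<sigma> by (simp add: facets_def d_def)
  have keys: "Poly_Mapping.keys (bd c) \<subseteq> cells_of_dim \<Sigma> (k - 1)" if "c \<in> cells_of_dim \<Sigma> k" for c k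
    using bd that by (auto simp: cellular_boundary_def cells_of_dim_def Let_def)
  have K_d: "{c \<in> K. cw_dim \<Sigma> c = d} = \<Upsilon>"
    using \<Upsilon> by (auto simp: K_def spanning_subcomplex_def facets_def cells_of_dim_def d_def)
  \<comment> \<open>Below the top dimension the forest contains every cell, so its chains there are
    those of the whole complex.\<close>
  have K_less: "{c \<in> K. cw_dim \<Sigma> c = k} = cells_of_dim \<Sigma> k" if "k < d" for k
    using \<Upsilon> that by (auto simp: K_def spanning_subcomplex_def facets_def cells_of_dim_def d_def)
  have sub: "subgroup (cellular_cycles \<Sigma> bd K (d - 1)) (cellular_chains \<Sigma> K (d - 1))"
  proof (rule subgroup_cellular_cycles)
    fix c assume "c \<in> K" "cw_dim \<Sigma> c = d - 1"
    then have "c \<in> cells_of_dim \<Sigma> (d - 1)"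
      using K_less[of "d - 1"] by auto
    then show "Poly_Mapping.keys (bd c) \<subseteq> {c \<in> K. cw_dim \<Sigma> c = d - 1 - 1}"
      using keys[of c "d - 1"] K_less[of "d - 1 - 1"] by simp
  qed
  have cycle: "bd \<sigma> \<in> cellular_cycles \<Sigma> bd K (d - 1)"
    using boundary_squared[OF bd \<sigma>'] keys[OF \<sigma>'] K_less[of "d - 1"] by (simp add: cellular_cycles_iff)
  have cycle0: "0 \<in> cellular_cycles \<Sigma> bd K (d - 1)"
    by (simp add: cellular_cycles_iff)
  obtain f where f: "f \<in> iso (cellular_homology \<Sigma> bd K (d - 1)) (cellular_homology \<Sigma> bd (cw_cells \<Sigma>) (d - 1))"
    and f_class: "\<And>z. z \<in> cellular_cycles \<Sigma> bd K (d - 1) \<Longrightarrow>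
      f (homology_class \<Sigma> bd K (d - 1) z) = homology_class \<Sigma> bd (cw_cells \<Sigma>) (d - 1) z"
    using iso unfolding inclusion_induces_iso_def K_def d_def by blast
  \<comment> \<open>The bounding chain in the whole complex is the facet itself.\<close>
  have "bd \<sigma> - 0 \<in> cellular_boundaries \<Sigma> bd (cw_cells \<Sigma>) (d - 1)"
    unfolding cellular_boundaries_def
  proof (rule image_eqI)
    show "frag_of \<sigma> \<in> carrier (cellular_chains \<Sigma> (cw_cells \<Sigma>) (d - 1 + 1))"
      using \<sigma>' by (simp add: cellular_chains_def cells_of_dim_def)
  qed simp
  then have "f (homology_class \<Sigma> bd K (d - 1) (bd \<sigma>)) = f (homology_class \<Sigma> bd K (d - 1) 0)"
    unfolding f_class[OF cycle] f_class[OF cycle0] homology_class_eq_iff .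
  moreover have "inj_on f (carrier (cellular_homology \<Sigma> bd K (d - 1)))"
    using f by (simp add: iso_def bij_betw_def)
  ultimately have "homology_class \<Sigma> bd K (d - 1) (bd \<sigma>) = homology_class \<Sigma> bd K (d - 1) 0"
    using homology_class_in_cellular_homology[OF sub] cycle cycle0 by (blast dest: inj_onD)
  then have "bd \<sigma> \<in> cellular_boundaries \<Sigma> bd K (d - 1)"
    unfolding homology_class_eq_iff by simp
  then obtain y where "Poly_Mapping.keys y \<subseteq> {c \<in> K. cw_dim \<Sigma> c = d}" "bd \<sigma> = frag_extend bd y"
    by (auto simp: cellular_boundaries_def cellular_chains_def)
  then show thesis
    using that K_d by simp
qed

section \<open>Real linear relations among the columns of the boundary matrix\<close>

lemma lookup_frag_extend:
  assumes "finite A" "Poly_Mapping.keys x \<subseteq> A"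
  shows "Poly_Mapping.lookup (frag_extend b x) \<rho> = (\<Sum>\<sigma>\<in>A. Poly_Mapping.lookup x \<sigma> * Poly_Mapping.lookup (b \<sigma>) \<rho>)"
proof -
  have "Poly_Mapping.lookup (frag_extend b x) \<rho>
      = (\<Sum>\<sigma>\<in>Poly_Mapping.keys x. Poly_Mapping.lookup x \<sigma> * Poly_Mapping.lookup (b \<sigma>) \<rho>)"
    by (simp add: frag_extend_def lookup_sum)
  also have "\<dots> = (\<Sum>\<sigma>\<in>A. Poly_Mapping.lookup x \<sigma> * Poly_Mapping.lookup (b \<sigma>) \<rho>)"
    using assms by (intro sum.mono_neutral_left) (auto simp: in_keys_iff)
  finally show ?thesis .
qed

definition real_relation :: "('c \<Rightarrow> ('c \<Rightarrow>\<^sub>0 int)) \<Rightarrow> 'c set \<Rightarrow> ('c \<Rightarrow> real) \<Rightarrow> bool" where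
  "real_relation bd A a \<longleftrightarrow> (\<forall>\<rho>. (\<Sum>\<sigma>\<in>A. a \<sigma> * real_of_int (Poly_Mapping.lookup (bd \<sigma>) \<rho>)) = 0)"

lemma cellular_independent_iff:
  "cellular_independent \<Sigma> bd A \<longleftrightarrow> A \<subseteq> facets \<Sigma> \<and> (\<forall>a. real_relation bd A a \<longrightarrow> (\<forall>\<sigma>\<in>A. a \<sigma> = 0))"
  by (simp add: cellular_independent_def real_relation_def)

text \<open>The bridge from integral flows to the matroid, which is represented over the
  reals.\<close>

lemma real_relation_of_int:
  assumes "finite A" "Poly_Mapping.keys x \<subseteq> A" "frag_extend bd x = 0"
  shows "real_relation bd A (\<lambda>\<sigma>. real_of_int (Poly_Mapping.lookup x \<sigma>))"
  unfolding real_relation_def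
proof
  fix \<rho>
  have "real_of_int (\<Sum>\<sigma>\<in>A. Poly_Mapping.lookup x \<sigma> * Poly_Mapping.lookup (bd \<sigma>) \<rho>) = 0"
    using lookup_frag_extend[OF assms(1,2), of bd \<rho>] assms(3) by simp
  then show "(\<Sum>\<sigma>\<in>A. real_of_int (Poly_Mapping.lookup x \<sigma>) * real_of_int (Poly_Mapping.lookup (bd \<sigma>) \<rho>)) = 0"
    by simp
qed

lemma real_relation_extend_by_zero:
  assumes "finite B" "A \<subseteq> B"
  shows "real_relation bd B (\<lambda>\<sigma>. if \<sigma> \<in> A then a \<sigma> else 0) \<longleftrightarrow> real_relation bd A a"
proof -
  have "(\<Sum>\<sigma>\<in>B. (if \<sigma> \<in> A then a \<sigma> else 0) * real_of_int (Poly_Mapping.lookup (bd \<sigma>) \<rho>))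
      = (\<Sum>\<sigma>\<in>A. a \<sigma> * real_of_int (Poly_Mapping.lookup (bd \<sigma>) \<rho>))" for \<rho>
    using assms by (intro sum.mono_neutral_cong_right) auto
  then show ?thesis
    by (simp only: real_relation_def)
qed

lemma independent_imp_flow_eq_0:
  assumes "cellular_independent \<Sigma> bd A" "finite A" "Poly_Mapping.keys x \<subseteq> A" "frag_extend bd x = 0"
  shows "x = 0"
proof -
  have "\<forall>\<sigma>\<in>A. real_of_int (Poly_Mapping.lookup x \<sigma>) = 0"
    using assms(1) real_relation_of_int[OF assms(2-4)] unfolding cellular_independent_iff by blast
  then have "Poly_Mapping.lookup x \<sigma> = 0" for \<sigma>
    using assms(3) by (cases "\<sigma> \<in> A") (auto simp: in_keys_iff)
  then show ?thesis
    by (intro poly_mapping_eqI) simp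
qed

text \<open>The relations on \<open>insert \<sigma> \<Upsilon>\<close> form a line spanned by
  \<open>w\<close>, so every nonzero relation there has the same support as \<open>w\<close>. This
  yields both the circuit property and uniqueness.\<close>

lemma circ_eq_keys:
  assumes fin: "finite \<Upsilon>" and ind: "cellular_independent \<Sigma> bd \<Upsilon>" and \<sigma>: "\<sigma> \<in> facets \<Sigma>" "\<sigma> \<notin> \<Upsilon>"
    and keys: "Poly_Mapping.keys w \<subseteq> insert \<sigma> \<Upsilon>" and w\<sigma>: "Poly_Mapping.lookup w \<sigma> = 1"
    and flow: "frag_extend bd w = 0"
  shows "cellular_circuit \<Sigma> bd (Poly_Mapping.keys w)" "circ \<Sigma> bd \<Upsilon> \<sigma> = Poly_Mapping.keys w"
proof -
  let ?C = "Poly_Mapping.keys w" and ?w = "\<lambda>\<tau>. real_of_int (Poly_Mapping.lookup w \<tau>)"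
  have facets: "insert \<sigma> \<Upsilon> \<subseteq> facets \<Sigma>"
    using ind \<sigma> by (simp add: cellular_independent_def)
  have fin': "finite (insert \<sigma> \<Upsilon>)" using fin by simp
  have multiple: "a \<tau> = a \<sigma> * ?w \<tau>" if a: "real_relation bd (insert \<sigma> \<Upsilon>) a" and \<tau>: "\<tau> \<in> insert \<sigma> \<Upsilon>" for a \<tau>
  proof -
    have "real_relation bd \<Upsilon> (\<lambda>\<tau>. a \<tau> - a \<sigma> * ?w \<tau>)"
      unfolding real_relation_def
    proof
      fix \<rho>
      let ?b = "\<lambda>\<tau>. real_of_int (Poly_Mapping.lookup (bd \<tau>) \<rho>)"
      \<comment> \<open>The added term at \<open>\<sigma>\<close> is zero because \<open>w\<close>
        has coefficient 1 there.\<close>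
      have "(\<Sum>\<tau>\<in>\<Upsilon>. (a \<tau> - a \<sigma> * ?w \<tau>) * ?b \<tau>) = (\<Sum>\<tau>\<in>insert \<sigma> \<Upsilon>. (a \<tau> - a \<sigma> * ?w \<tau>) * ?b \<tau>)"
        using fin \<sigma> w\<sigma> by simp
      also have "\<dots> = (\<Sum>\<tau>\<in>insert \<sigma> \<Upsilon>. a \<tau> * ?b \<tau>) - a \<sigma> * (\<Sum>\<tau>\<in>insert \<sigma> \<Upsilon>. ?w \<tau> * ?b \<tau>)"
        by (simp only: left_diff_distrib sum_subtractf sum_distrib_left mult.assoc)
      also have "\<dots> = 0"
        using a real_relation_of_int[OF fin' keys flow] by (simp only: real_relation_def mult_zero_right diff_0_right)
      finally show "(\<Sum>\<tau>\<in>\<Upsilon>. (a \<tau> - a \<sigma> * ?w \<tau>) * ?b \<tau>) = 0" .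
    qed
    then have "\<forall>\<tau>\<in>\<Upsilon>. a \<tau> - a \<sigma> * ?w \<tau> = 0"
      using ind unfolding cellular_independent_iff by blast
    then show ?thesis
      using \<tau> w\<sigma> by auto
  qed
  have support: "?C \<subseteq> A \<or> (\<forall>\<tau>\<in>A. a \<tau> = 0)" if "real_relation bd A a" "A \<subseteq> insert \<sigma> \<Upsilon>" for A a
  proof -
    let ?a = "\<lambda>\<tau>. if \<tau> \<in> A then a \<tau> else 0"
    have rel: "real_relation bd (insert \<sigma> \<Upsilon>) ?a"
      using that real_relation_extend_by_zero[OF fin'] by blast
    show ?thesis
    proof (cases "?a \<sigma> = 0")
      case True
      have "a \<tau> = 0" if "\<tau> \<in> A" for \<tau>
        using multiple[OF rel, of \<tau>] True that \<open>A \<subseteq> insert \<sigma> \<Upsilon>\<close> by (simp split: if_splits) blast+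
      then show ?thesis by blast
    next
      case False
      have "\<tau> \<in> A" if "\<tau> \<in> ?C" for \<tau>
        using multiple[OF rel, of \<tau>] False that keys by (auto simp: in_keys_iff split: if_splits)
      then show ?thesis by blast
    qed
  qed
  have dependent: "\<not> cellular_independent \<Sigma> bd ?C"
  proof
    assume "cellular_independent \<Sigma> bd ?C"
    then have "w = 0"
      using independent_imp_flow_eq_0 flow by (metis finite_keys order_refl)
    then show False using w\<sigma> by simp
  qed
  show circuit: "cellular_circuit \<Sigma> bd ?C"
    unfolding cellular_circuit_def
  proof (intro conjI allI impI dependent)
    show "?C \<subseteq> facets \<Sigma>" using keys facets by blast
    fix A assume A: "A \<subset> ?C"
    then have "A \<subseteq> insert \<sigma> \<Upsilon>" using keys by blast
    then show "cellular_independent \<Sigma> bd A"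
      unfolding cellular_independent_iff using support A facets by blast
  qed
  show "circ \<Sigma> bd \<Upsilon> \<sigma> = ?C"
    unfolding circ_def
  proof (rule the_equality)
    show "cellular_circuit \<Sigma> bd ?C \<and> ?C \<subseteq> insert \<sigma> \<Upsilon>"
      using circuit keys by blast
    fix C assume C: "cellular_circuit \<Sigma> bd C \<and> C \<subseteq> insert \<sigma> \<Upsilon>"
    then have "C \<subseteq> facets \<Sigma>" "\<not> cellular_independent \<Sigma> bd C"
      and minimal: "\<And>A. A \<subset> C \<Longrightarrow> cellular_independent \<Sigma> bd A"
      unfolding cellular_circuit_def by auto
    then obtain a where a: "real_relation bd C a" "\<not> (\<forall>\<tau>\<in>C. a \<tau> = 0)"
      unfolding cellular_independent_iff by blast
    have "?C \<subseteq> C"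
      \<comment> \<open>A dependent set inside \<open>insert \<sigma> \<Upsilon>\<close> carries a
        nonzero relation and so contains the support of \<open>w\<close>; minimality of circuits
        then gives equality.\<close>
      using support[OF a(1)] a(2) C by blast
    moreover have "\<not> ?C \<subset> C"
      using minimal dependent by blast
    ultimately show "C = ?C" by simp
  qed
qed

theorem theorem6p2:
  fixes \<Sigma> :: "('a, 'c) cw_complex"
    and bd :: "'c \<Rightarrow> ('c \<Rightarrow>\<^sub>0 int)"
    and \<Upsilon> :: "'c set"
    and d :: int
    and \<psi> :: "'c set \<Rightarrow> ('c \<Rightarrow>\<^sub>0 int)"
  assumes "finite_cw_complex \<Sigma>"
    and "cw_dimension \<Sigma> = d"
    and "cellular_boundary \<Sigma> bd"
    and "cellular_spanning_forest \<Sigma> bd \<Upsilon>"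
    and "inclusion_induces_iso \<Sigma> bd (spanning_subcomplex \<Sigma> \<Upsilon>) (cw_cells \<Sigma>) (d - 1)"
    and "\<And>C. cellular_circuit \<Sigma> bd C \<Longrightarrow> circuit_vector \<Sigma> bd C (\<psi> C)"
  shows "integral_basis (flow_lattice \<Sigma> bd)
           ((\<lambda>\<sigma>. \<psi> (circ \<Sigma> bd \<Upsilon> \<sigma>)) ` (cells_of_dim \<Sigma> d - \<Upsilon>))"
proof -
  interpret finite_cw \<Sigma>
    using assms(1) by unfold_locales
  have facets: "facets \<Sigma> = cells_of_dim \<Sigma> d"
    by (simp add: facets_def assms(2))
  have \<Upsilon>: "\<Upsilon> \<subseteq> facets \<Sigma>" "cellular_independent \<Sigma> bd \<Upsilon>"
    using assms(4) by (simp_all add: cellular_spanning_forest_def cellular_basis_def)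
  have fin: "finite \<Upsilon>"
    using \<Upsilon>(1) finite_cells_of_dim by (auto simp: facets intro: finite_subset)
  have flow_iff: "x \<in> flow_lattice \<Sigma> bd \<longleftrightarrow> Poly_Mapping.keys x \<subseteq> cells_of_dim \<Sigma> d \<and> frag_extend bd x = 0" for x
    by (simp add: flow_lattice_def cellular_cycles_iff assms(2) cells_of_dim_def)
  have \<psi>: "\<psi> (circ \<Sigma> bd \<Upsilon> \<sigma>) \<in> flow_lattice \<Sigma> bd \<and> Poly_Mapping.keys (\<psi> (circ \<Sigma> bd \<Upsilon> \<sigma>)) \<subseteq> insert \<sigma> \<Upsilon>
      \<and> \<bar>Poly_Mapping.lookup (\<psi> (circ \<Sigma> bd \<Upsilon> \<sigma>)) \<sigma>\<bar> = 1"
    if \<sigma>: "\<sigma> \<in> cells_of_dim \<Sigma> d - \<Upsilon>" for \<sigma>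
  proof -
    obtain y where y: "Poly_Mapping.keys y \<subseteq> \<Upsilon>" "bd \<sigma> = frag_extend bd y"
      using facet_boundary_in_forest_boundaries[of bd \<Upsilon> \<sigma>] assms(2,3,5) \<Upsilon>(1) \<sigma> by (auto simp: facets)
    define w where "w = frag_of \<sigma> - y"
    have "\<sigma> \<notin> Poly_Mapping.keys y" using y \<sigma> by blast
    then have w\<sigma>: "Poly_Mapping.lookup w \<sigma> = 1"
      by (simp add: w_def lookup_minus in_keys_iff)
    have keys: "Poly_Mapping.keys w \<subseteq> insert \<sigma> \<Upsilon>"
      using y keys_diff[of "frag_of \<sigma>" y] by (auto simp: w_def)
    have flow: "frag_extend bd w = 0"
      by (simp add: w_def frag_extend_diff y)
    have "w \<in> flow_lattice \<Sigma> bd"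
      using keys \<sigma> \<Upsilon>(1) flow by (auto simp: flow_iff facets)
    note circ = circ_eq_keys[OF fin \<Upsilon>(2) _ _ keys w\<sigma> flow]
    let ?v = "\<psi> (circ \<Sigma> bd \<Upsilon> \<sigma>)"
    have C: "circ \<Sigma> bd \<Upsilon> \<sigma> = Poly_Mapping.keys w" and "cellular_circuit \<Sigma> bd (Poly_Mapping.keys w)"
      using circ \<sigma> by (auto simp: facets)
    from assms(6)[OF this(2)]
    have range: "{x \<in> flow_lattice \<Sigma> bd. Poly_Mapping.keys x \<subseteq> Poly_Mapping.keys w} = range (\<lambda>m. frag_cmul m ?v)"
      by (simp add: circuit_vector_def C)
    have "frag_cmul 1 ?v \<in> range (\<lambda>m. frag_cmul m ?v)" by (rule rangeI)
    then have v: "?v \<in> flow_lattice \<Sigma> bd" "Poly_Mapping.keys ?v \<subseteq> Poly_Mapping.keys w"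
      unfolding range[symmetric] by simp_all
    \<comment> \<open>\<open>w\<close> is an integer multiple of the circuit vector; comparing
      coefficients at \<open>\<sigma>\<close> writes 1 as a product of integers, so the coefficient
      of the circuit vector is a unit.\<close>
    have "w \<in> range (\<lambda>m. frag_cmul m ?v)"
      unfolding range[symmetric] using \<open>w \<in> flow_lattice \<Sigma> bd\<close> by simp
    then obtain m where "w = frag_cmul m ?v" by blast
    then have "m * Poly_Mapping.lookup ?v \<sigma> = 1"
      using w\<sigma> by (metis lookup_frag_cmul)
    then have "\<bar>Poly_Mapping.lookup ?v \<sigma>\<bar> = 1"
      by (auto simp: zmult_eq_1_iff)
    then show ?thesis
      using v keys by blast
  qed
  show ?thesis
  proof (rule integral_basis_triangular[where \<epsilon> = "\<lambda>\<sigma>. Poly_Mapping.lookup (\<psi> (circ \<Sigma> bd \<Upsilon> \<sigma>)) \<sigma>"])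
    show "finite (cells_of_dim \<Sigma> d - \<Upsilon>)"
      by (simp add: finite_cells_of_dim)
    show "x + y \<in> flow_lattice \<Sigma> bd" if "x \<in> flow_lattice \<Sigma> bd" "y \<in> flow_lattice \<Sigma> bd" for x y
      using that keys_add[of x y] by (auto simp: flow_iff frag_extend_add)
    show "frag_cmul m x \<in> flow_lattice \<Sigma> bd" if "x \<in> flow_lattice \<Sigma> bd" for m x
      using that by (auto simp: flow_iff frag_extend_cmul)
    show "0 \<in> flow_lattice \<Sigma> bd"
      by (simp add: flow_iff)
    fix s assume s: "s \<in> cells_of_dim \<Sigma> d - \<Upsilon>"
    let ?v = "\<psi> (circ \<Sigma> bd \<Upsilon> s)"
    show "?v \<in> flow_lattice \<Sigma> bd"
      using \<psi>[OF s] by simp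
    show "Poly_Mapping.lookup ?v s * Poly_Mapping.lookup ?v s = 1"
      using \<psi>[OF s] by (metis abs_mult_self_eq mult_1)
    \<comment> \<open>Off the diagonal, \<open>t\<close> lies neither in \<open>\<Upsilon>\<close>
      nor equals \<open>s\<close>, so it is outside the support of \<open>?v\<close>.\<close>
    show "Poly_Mapping.lookup ?v t = (if s = t then Poly_Mapping.lookup ?v s else 0)"
      if t: "t \<in> cells_of_dim \<Sigma> d - \<Upsilon>" for t
      using \<psi>[OF s] t by (auto simp: in_keys_iff)
  next
    fix x assume x: "x \<in> flow_lattice \<Sigma> bd"
      and zero: "\<And>s. s \<in> cells_of_dim \<Sigma> d - \<Upsilon> \<Longrightarrow> Poly_Mapping.lookup x s = 0"
    \<comment> \<open>A flow that vanishes off the forest is a relation among the independent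
      columns of \<open>\<Upsilon>\<close>.\<close>
    have "Poly_Mapping.keys x \<subseteq> \<Upsilon>"
      using x zero by (auto simp: flow_iff in_keys_iff)
    then show "x = 0"
      using independent_imp_flow_eq_0[OF \<Upsilon>(2) fin] x by (simp add: flow_iff)
  qed
qed

end
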